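(* There exists a domain $\Omega \subset B_1 \subset \mathbb{R}^2$, with $\sup_{x \in \Omega}|x| = 1$, such that $C_2(\Omega) > \frac{1}{4}$ and $C_2(\Omega)$ is not attained by any $u \in W^{1,2}_0(\Omega)$, $u \not\equiv 0$.
   Context: A domain is a nonempty connected open set. $B_1$ denotes the open unit disk in $\mathbb{R}^2$ centered at $0$. For a bounded domain $\Omega \subset \mathbb{R}^2$ with $R = \sup_{x \in \Omega}|x|$, define $$C_2(\Omega) = \inf_{u \in W^{1,2}_0(\Omega),\ u \not\equiv 0} \frac{\int_\Omega |\nabla u|^2\,dx}{\int_\Omega \frac{|u(x)|^2}{|x|^2 \left( \log \frac{R}{|x|} \right)^2}\,dx}.$$ The infimum is said to be attained if some $u \in W^{1,2}_0(\Omega)$, $u \not\equiv 0$, realizes equality in the quotient. *)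

theory Defs
  imports "HOL-Analysis.Analysis"
begin

definition domain_set :: "'a::topological_space set \<Rightarrow> bool" where
  "domain_set \<Omega> \<longleftrightarrow> open \<Omega> \<and> connected \<Omega> \<and> \<Omega> \<noteq> {}"

definition partial_deriv :: "'a::euclidean_space \<Rightarrow> ('a \<Rightarrow> real) \<Rightarrow> 'a \<Rightarrow> real" where
  "partial_deriv b f x = frechet_derivative f (at x) b"

definition grad :: "('a::euclidean_space \<Rightarrow> real) \<Rightarrow> 'a \<Rightarrow> 'a" where
  "grad f x = (\<Sum>b\<in>Basis. partial_deriv b f x *\<^sub>R b)"

(* Continuity of the derivative in the Suc case comes from the partial derivatives
   being C_k, hence continuous. *)
fun C_k :: "nat \<Rightarrow> ('a::euclidean_space \<Rightarrow> real) \<Rightarrow> bool" where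
  "C_k 0 f \<longleftrightarrow> continuous_on UNIV f"
| "C_k (Suc k) f \<longleftrightarrow> (\<forall>x. f differentiable at x) \<and> (\<forall>b\<in>Basis. C_k k (partial_deriv b f))"

(* The space of smooth functions with compact support in \<Omega>; its elements are taken to be
   defined, and smooth, on the whole space (extended by zero). *)
definition test_functions :: "'a::euclidean_space set \<Rightarrow> ('a \<Rightarrow> real) set" where
  "test_functions \<Omega> = {\<phi>. (\<forall>k. C_k k \<phi>) \<and> compact (closure {x. \<phi> x \<noteq> 0})
                          \<and> closure {x. \<phi> x \<noteq> 0} \<subseteq> \<Omega>}"

(* Functions on \<Omega> are represented by functions on the whole space, of which only the
   values on \<Omega> are ever used, and are identified when equal a.e. on \<Omega>. *)
definition L2_sq :: "'a::euclidean_space set \<Rightarrow> ('a \<Rightarrow> 'b::euclidean_space) \<Rightarrow> ennreal" where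
  "L2_sq \<Omega> f = (\<integral>\<^sup>+x. ennreal ((norm (f x))\<^sup>2) \<partial>lebesgue_on \<Omega>)"

definition L2 :: "'a::euclidean_space set \<Rightarrow> ('a \<Rightarrow> 'b::euclidean_space) set" where
  "L2 \<Omega> = {f. f \<in> borel_measurable (lebesgue_on \<Omega>) \<and> L2_sq \<Omega> f < \<infinity>}"

(* The products below are integrable when u and g are in L2 \<Omega>, the only case used. *)
definition has_weak_gradient ::
    "'a::euclidean_space set \<Rightarrow> ('a \<Rightarrow> real) \<Rightarrow> ('a \<Rightarrow> 'a) \<Rightarrow> bool" where
  "has_weak_gradient \<Omega> u g \<longleftrightarrow>
     (\<forall>\<phi>\<in>test_functions \<Omega>. \<forall>b\<in>Basis.
        (\<integral>x. u x * partial_deriv b \<phi> x \<partial>lebesgue_on \<Omega>)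
          = - (\<integral>x. (g x \<bullet> b) * \<phi> x \<partial>lebesgue_on \<Omega>))"

(* W12 and W12_0 consist of the pairs (u, g) such that u belongs to the Sobolev space in
   question and g is its weak gradient, which u determines up to a null set. *)
definition W12 :: "'a::euclidean_space set \<Rightarrow> (('a \<Rightarrow> real) \<times> ('a \<Rightarrow> 'a)) set" where
  "W12 \<Omega> = {(u, g). u \<in> L2 \<Omega> \<and> g \<in> L2 \<Omega> \<and> has_weak_gradient \<Omega> u g}"

(* The closure of the test functions in the norm of W12. *)
definition W12_0 :: "'a::euclidean_space set \<Rightarrow> (('a \<Rightarrow> real) \<times> ('a \<Rightarrow> 'a)) set" where
  "W12_0 \<Omega> = {(u, g) \<in> W12 \<Omega>. \<exists>\<phi>. (\<forall>n::nat. \<phi> n \<in> test_functions \<Omega>) \<and>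
     (\<lambda>n. L2_sq \<Omega> (\<lambda>x. u x - \<phi> n x) + L2_sq \<Omega> (\<lambda>x. g x - grad (\<phi> n) x)) \<longlonglongrightarrow> 0}"

definition W12_0_nonzero :: "'a::euclidean_space set \<Rightarrow> (('a \<Rightarrow> real) \<times> ('a \<Rightarrow> 'a)) set" where
  "W12_0_nonzero \<Omega> = {(u, g) \<in> W12_0 \<Omega>. \<not> (AE x in lebesgue_on \<Omega>. u x = 0)}"

definition outer_radius :: "(real^2) set \<Rightarrow> real" where
  "outer_radius \<Omega> = (SUP x\<in>\<Omega>. norm x)"

(* For u not a.e. zero the denominator is positive, so 0 / 0 does not occur; a quotient
   with infinite denominator and finite numerator is 0 in ennreal. At the single point
   x = 0 the weight has the junk value 0. *)
definition hardy_quotient :: "(real^2) set \<Rightarrow> (real^2 \<Rightarrow> real) \<Rightarrow> (real^2 \<Rightarrow> real^2) \<Rightarrow> ennreal" where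
  "hardy_quotient \<Omega> u g =
     (\<integral>\<^sup>+x. ennreal ((norm (g x))\<^sup>2) \<partial>lebesgue_on \<Omega>) /
     (\<integral>\<^sup>+x. ennreal (\<bar>u x\<bar>\<^sup>2 / ((norm x)\<^sup>2 * (ln (outer_radius \<Omega> / norm x))\<^sup>2)) \<partial>lebesgue_on \<Omega>)"

definition C2 :: "(real^2) set \<Rightarrow> ennreal" where
  "C2 \<Omega> = (INF (u, g)\<in>W12_0_nonzero \<Omega>. hardy_quotient \<Omega> u g)"

definition C2_attained :: "(real^2) set \<Rightarrow> bool" where
  "C2_attained \<Omega> \<longleftrightarrow> (\<exists>(u, g)\<in>W12_0_nonzero \<Omega>. hardy_quotient \<Omega> u g = C2 \<Omega>)"

end

theory Submission
  imports Defs
begin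

text \<open>
  The domain is a curvilinear corner touching the unit circle at one point, seen in coordinates in
  which the weight depends on one variable only. Write a point as \<open>x = exp (- exp w)\<close> with complex
  \<open>w = s + i p\<close>. The inner exponential \<open>y = exp w\<close> are polar coordinates, and
  \<open>- log \<bar>x\<bar> = Re y = exp s * cos p\<close>. The map is conformal, so the Dirichlet integral is the same in
  \<open>w\<close> as in \<open>x\<close>, while the weight \<open>1 / (\<bar>x\<bar> log \<bar>x\<bar>)\<^sup>2\<close> times the Jacobian is just \<open>1 / (cos p)\<^sup>2\<close>. On
  the half-strip \<open>s < 0\<close>, \<open>\<bar>p\<bar> < pi / 4\<close>, whose image is \<open>Omega\<close>, the Hardy quotient of \<open>v\<close> therefore
  becomes the integral of \<open>v\<^sub>s\<^sup>2 + v\<^sub>p\<^sup>2\<close> divided by that of \<open>v\<^sup>2 / (cos p)\<^sup>2\<close>, where the potential depends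
  on \<open>p\<close> alone. The end \<open>s \<longlonglongrightarrow> - \<infinity>\<close> is the tip at which \<open>Omega\<close> meets the circle.

  The constant is at least \<open>2\<close>: a Poincare inequality in \<open>p\<close> on an interval of length \<open>pi / 2\<close> bounds
  the integral of \<open>v\<^sub>p\<^sup>2\<close> from below by \<open>4\<close> times that of \<open>v\<^sup>2\<close>, and \<open>(cos p)\<^sup>2 \<ge> 1 / 2\<close> there
  (\<open>angular_poincare\<close>).

  The constant is not attained because the energy in \<open>s\<close> can be stretched away. Let \<open>l\<close> be the
  constant. Replacing \<open>v (s, p)\<close> by \<open>v (\<epsilon> s, p)\<close> keeps the half-strip, multiplies the weight integral
  and the \<open>p\<close>-energy by \<open>1 / \<epsilon>\<close> but the \<open>s\<close>-energy by \<open>\<epsilon>\<close>. Letting \<open>\<epsilon>\<close> tend to \<open>0\<close> shows that the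
  \<open>p\<close>-energy alone dominates \<open>l\<close> times the weight integral (\<open>angular_inequality_from_full\<close>). The
  \<open>s\<close>-energy is then left over, and the one-dimensional Hardy inequality on \<open>s < 0\<close> bounds it below by
  the integral of \<open>v\<^sup>2 / (4 s\<^sup>2)\<close> (\<open>radial_hardy\<close>). So the inequality with constant \<open>l\<close> holds with a
  strictly positive remainder; by Fatou's lemma this persists in the closure of the test functions
  (\<open>W12_0_weighted_inequality\<close>), and equality forces the function to vanish almost everywhere.

  Both one-dimensional inequalities are instances of one integration by parts
  (\<open>picone_inequality\<close>).
\<close>

section \<open>Smooth functions on open sets\<close>

text \<open>The coordinate maps are smooth only on open subsets of the plane, so the notion of smoothness has
to be localised before functions can be composed with them.\<close>

fun Ck_on :: "nat \<Rightarrow> 'a::euclidean_space set \<Rightarrow> ('a \<Rightarrow> real) \<Rightarrow> bool" where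
  "Ck_on 0 A f \<longleftrightarrow> continuous_on A f"
| "Ck_on (Suc k) A f \<longleftrightarrow>
     (\<forall>x\<in>A. f differentiable at x) \<and> (\<forall>b\<in>Basis. Ck_on k A (partial_deriv b f))"

definition smooth_on :: "'a::euclidean_space set \<Rightarrow> ('a \<Rightarrow> real) \<Rightarrow> bool" where
  "smooth_on A f \<longleftrightarrow> (\<forall>k. Ck_on k A f)"

lemma C_k_iff_Ck_on: "C_k k f \<longleftrightarrow> Ck_on k UNIV f"
  by (induction k arbitrary: f) auto

lemma frechet_derivative_eq_partial_deriv:
  "(\<lambda>x. frechet_derivative f (at x) b) = partial_deriv b f"
  by (simp add: partial_deriv_def fun_eq_iff)

lemma partial_deriv_eqI:
  "(f has_derivative f') (at x) \<Longrightarrow> partial_deriv b f x = f' b"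
  unfolding partial_deriv_def using frechet_derivative_at by metis

lemma has_derivative_partial_sum:
  fixes f :: "'a::euclidean_space \<Rightarrow> real"
  assumes "f differentiable at x"
  shows "(f has_derivative (\<lambda>h. \<Sum>b\<in>Basis. (h \<bullet> b) * partial_deriv b f x)) (at x)"
proof -
  have d: "(f has_derivative frechet_derivative f (at x)) (at x)"
    using assms frechet_derivative_works by blast
  then interpret linear "frechet_derivative f (at x)"
    using has_derivative_linear by blast
  have "frechet_derivative f (at x) h = (\<Sum>b\<in>Basis. (h \<bullet> b) * partial_deriv b f x)" for h
    unfolding partial_deriv_def
    by (subst (1) euclidean_representation[of h, symmetric]) (simp only: sum scale, simp)
  then have "frechet_derivative f (at x) = (\<lambda>h. \<Sum>b\<in>Basis. (h \<bullet> b) * partial_deriv b f x)" ..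
  with d show ?thesis by metis
qed

lemma partial_deriv_cong:
  assumes "open A" "x \<in> A" "\<And>y. y \<in> A \<Longrightarrow> f y = g y"
  shows "partial_deriv b f x = partial_deriv b g x"
proof -
  have "(f has_derivative f') (at x) \<longleftrightarrow> (g has_derivative f') (at x)" for f'
    using has_derivative_transform_within_open[OF _ assms(1,2), of f f' UNIV g]
      has_derivative_transform_within_open[OF _ assms(1,2), of g f' UNIV f] assms(3) by auto
  then show ?thesis unfolding partial_deriv_def frechet_derivative_def by simp
qed

text \<open>Off the open set \<open>A\<close> a partial derivative may take arbitrary values; only this congruence makes the
rules for products and compositions below usable, since their derivative formulas hold just on \<open>A\<close>.\<close>

lemma Ck_on_cong:
  assumes "open A" "\<And>y. y \<in> A \<Longrightarrow> f y = g y" "Ck_on k A f"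
  shows "Ck_on k A g"
  using assms(2,3)
proof (induction k arbitrary: f g)
  case 0
  then show ?case by (simp cong: continuous_on_cong)
next
  case (Suc k)
  have "g differentiable at x" if "x \<in> A" for x
    using Suc.prems that has_derivative_transform_within_open[OF _ assms(1) that, of f _ UNIV g]
    unfolding differentiable_def by (metis Ck_on.simps(2) differentiable_def)
  moreover have "Ck_on k A (partial_deriv b g)" if "b \<in> Basis" for b
    using Suc.IH[of "partial_deriv b f" "partial_deriv b g"] Suc.prems that
      partial_deriv_cong[OF assms(1), of _ f g b] by simp
  ultimately show ?case by simp
qed

lemma differentiable_at_imp_continuous_on: "(\<forall>x\<in>A. f differentiable at x) \<Longrightarrow> continuous_on A f"
  by (simp add: continuous_at_imp_continuous_on differentiable_imp_continuous_within)

lemma Ck_on_Suc_imp: "Ck_on (Suc k) A f \<Longrightarrow> Ck_on k A f"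
proof (induction k arbitrary: f)
  case 0
  then show ?case using differentiable_at_imp_continuous_on[of A f] by simp
next
  case (Suc k)
  from Suc.prems have "\<forall>x\<in>A. f differentiable at x"
    "\<forall>b\<in>Basis. Ck_on (Suc k) A (partial_deriv b f)" by simp_all
  with Suc.IH show ?case by simp
qed

lemma Ck_on_SucI:
  assumes "open A"
    "\<And>x. x \<in> A \<Longrightarrow> (f has_derivative f' x) (at x)"
    "\<And>b. b \<in> Basis \<Longrightarrow> Ck_on k A (\<lambda>x. f' x b)"
  shows "Ck_on (Suc k) A f"
proof -
  have "Ck_on k A (partial_deriv b f)" if "b \<in> Basis" for b
    by (rule Ck_on_cong[OF assms(1) _ assms(3)[OF that]]) (simp add: partial_deriv_eqI[OF assms(2)])
  then show ?thesis using assms(2) by (auto simp: differentiable_def)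
qed

lemma Ck_on_const: "open A \<Longrightarrow> Ck_on k A (\<lambda>x. c)"
proof (induction k arbitrary: c)
  case (Suc k)
  show ?case
    by (rule Ck_on_SucI[OF Suc.prems has_derivative_const]) (use Suc in simp)
qed simp

lemma Ck_on_inner:
  fixes A :: "'a::euclidean_space set"
  shows "open A \<Longrightarrow> Ck_on k A (\<lambda>x. x \<bullet> c)"
proof (cases k)
  case (Suc j)
  assume A: "open A"
  have "Ck_on (Suc j) A (\<lambda>x. x \<bullet> c)"
    by (rule Ck_on_SucI[OF A, where f'="\<lambda>x h. h \<bullet> c"]) (auto intro!: derivative_eq_intros Ck_on_const A)
  then show ?thesis using Suc by simp
qed (auto intro!: continuous_intros)

lemma Ck_on_add:
  assumes "open A"
  shows "Ck_on k A f \<Longrightarrow> Ck_on k A g \<Longrightarrow> Ck_on k A (\<lambda>x. f x + g x)"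
proof (induction k arbitrary: f g)
  case (Suc k)
  show ?case
  proof (rule Ck_on_SucI[OF assms])
    show "((\<lambda>x. f x + g x) has_derivative
        (\<lambda>h. frechet_derivative f (at x) h + frechet_derivative g (at x) h)) (at x)"
      if "x \<in> A" for x
      using Suc.prems that by (intro has_derivative_add) (auto simp: frechet_derivative_works[symmetric])
    show "Ck_on k A (\<lambda>x. frechet_derivative f (at x) b + frechet_derivative g (at x) b)"
      if "b \<in> Basis" for b
    proof -
      have "Ck_on k A (\<lambda>x. partial_deriv b f x + partial_deriv b g x)"
        by (rule Suc.IH) (use Suc.prems that in auto)
      then show ?thesis by (simp only: partial_deriv_def)
    qed
  qed
qed (auto intro!: continuous_intros)

lemma Ck_on_sum:
  assumes "open A" "finite I" "\<And>i. i \<in> I \<Longrightarrow> Ck_on k A (f i)"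
  shows "Ck_on k A (\<lambda>x. \<Sum>i\<in>I. f i x)"
  using assms(2,3) by (induction I rule: finite_induct) (auto intro: Ck_on_const Ck_on_add assms(1))

lemma Ck_on_mult:
  assumes "open A"
  shows "Ck_on k A f \<Longrightarrow> Ck_on k A g \<Longrightarrow> Ck_on k A (\<lambda>x. f x * g x)"
proof (induction k arbitrary: f g)
  case (Suc k)
  show ?case
  proof (rule Ck_on_SucI[OF assms])
    show "((\<lambda>x. f x * g x) has_derivative
        (\<lambda>h. f x * frechet_derivative g (at x) h + frechet_derivative f (at x) h * g x)) (at x)"
      if "x \<in> A" for x
      using Suc.prems that by (intro has_derivative_mult) (auto simp: frechet_derivative_works[symmetric])
    show "Ck_on k A (\<lambda>x. f x * frechet_derivative g (at x) b + frechet_derivative f (at x) b * g x)"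
      if "b \<in> Basis" for b
    proof -
      have "Ck_on k A (\<lambda>x. f x * partial_deriv b g x + partial_deriv b f x * g x)"
        by (rule Ck_on_add[OF assms Suc.IH[OF Ck_on_Suc_imp] Suc.IH[OF _ Ck_on_Suc_imp]])
          (use Suc.prems that in auto)
      then show ?thesis by (simp only: partial_deriv_def)
    qed
  qed
qed (auto intro!: continuous_intros)

lemma has_derivative_components:
  fixes T :: "'a::euclidean_space \<Rightarrow> 'b::euclidean_space"
  assumes "\<And>c. c \<in> Basis \<Longrightarrow> (\<lambda>x. T x \<bullet> c) differentiable at x"
  shows "(T has_derivative (\<lambda>h. \<Sum>c\<in>Basis. frechet_derivative (\<lambda>x. T x \<bullet> c) (at x) h *\<^sub>R c)) (at x)"
proof (subst has_derivative_componentwise_within, intro ballI)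
  fix c :: 'b assume c: "c \<in> Basis"
  have "(\<lambda>h. (\<Sum>c\<in>Basis. frechet_derivative (\<lambda>x. T x \<bullet> c) (at x) h *\<^sub>R c) \<bullet> c)
      = frechet_derivative (\<lambda>x. T x \<bullet> c) (at x)"
    using c by (simp add: inner_sum_left inner_Basis if_distrib sum.delta cong: if_cong)
  then show "((\<lambda>x. T x \<bullet> c) has_derivative
      (\<lambda>h. (\<Sum>c\<in>Basis. frechet_derivative (\<lambda>x. T x \<bullet> c) (at x) h *\<^sub>R c) \<bullet> c)) (at x)"
    using assms[OF c] frechet_derivative_works by metis
qed

text \<open>By the chain rule every partial derivative of \<open>f \<circ> T\<close> is a sum of products of partial derivatives of
the components of \<open>T\<close> with some \<open>\<partial>\<^sub>c f \<circ> T\<close>. The latter are compositions of lower order, to which the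
induction hypothesis applies.\<close>

lemma Ck_on_compose:
  fixes f :: "'b::euclidean_space \<Rightarrow> real" and T :: "'a::euclidean_space \<Rightarrow> 'b"
  assumes "open A" "T ` A \<subseteq> B"
  shows "\<lbrakk>Ck_on k B f; \<And>c. c \<in> Basis \<Longrightarrow> Ck_on k A (\<lambda>x. T x \<bullet> c)\<rbrakk> \<Longrightarrow> Ck_on k A (\<lambda>x. f (T x))"
proof (induction k arbitrary: f)
  case 0
  have "continuous_on A T"
    using 0(2) by (subst continuous_on_componentwise) auto
  then show ?case using 0(1) assms(2) by (auto intro: continuous_on_compose2)
next
  case (Suc k)
  show ?case
  proof (rule Ck_on_SucI[OF assms(1)])
    show "((\<lambda>x. f (T x)) has_derivative
        (\<lambda>h. \<Sum>c\<in>Basis. frechet_derivative (\<lambda>x. T x \<bullet> c) (at x) h * partial_deriv c f (T x))) (at x)"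
      if x: "x \<in> A" for x
    proof -
      have "f differentiable at (T x)" using Suc.prems(1) assms(2) x by auto
      then have "(f has_derivative (\<lambda>h. \<Sum>b\<in>Basis. (h \<bullet> b) * partial_deriv b f (T x))) (at (T x))"
        by (rule has_derivative_partial_sum)
      moreover have "(T has_derivative
          (\<lambda>h. \<Sum>c\<in>Basis. frechet_derivative (\<lambda>x. T x \<bullet> c) (at x) h *\<^sub>R c)) (at x)"
        using Suc.prems(2) x by (intro has_derivative_components) simp
      ultimately have "((\<lambda>x. f (T x)) has_derivative
        (\<lambda>h. \<Sum>b\<in>Basis. ((\<Sum>c\<in>Basis. frechet_derivative (\<lambda>x. T x \<bullet> c) (at x) h *\<^sub>R c) \<bullet> b)
            * partial_deriv b f (T x))) (at x)"
        by (rule has_derivative_compose[rotated])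
      then show ?thesis
        by (simp add: inner_sum_left inner_Basis if_distrib sum.delta cong: if_cong)
    qed
    show "Ck_on k A (\<lambda>x. \<Sum>c\<in>Basis. frechet_derivative (\<lambda>x. T x \<bullet> c) (at x) b * partial_deriv c f (T x))"
      if b: "b \<in> Basis" for b
    proof (intro Ck_on_sum Ck_on_mult assms(1))
      fix c :: 'b assume c: "c \<in> Basis"
      show "Ck_on k A (\<lambda>x. frechet_derivative (\<lambda>x. T x \<bullet> c) (at x) b)"
        using Suc.prems(2)[OF c] b by (simp add: frechet_derivative_eq_partial_deriv)
      show "Ck_on k A (\<lambda>x. partial_deriv c f (T x))"
        by (rule Suc.IH[OF _ Ck_on_Suc_imp[OF Suc.prems(2)]]) (use Suc.prems(1) c in auto)
    qed simp
  qed
qed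

lemma Ck_on_Suc_real:
  fixes f f' :: "real \<Rightarrow> real"
  assumes "open J" "\<And>x. x \<in> J \<Longrightarrow> (f has_real_derivative f' x) (at x)" "Ck_on k J f'"
  shows "Ck_on (Suc k) J f"
  by (rule Ck_on_SucI[OF assms(1), where f'="\<lambda>x h. f' x * h"])
    (use assms in \<open>auto simp: has_field_derivative_def\<close>)

lemma smooth_on_const: "open A \<Longrightarrow> smooth_on A (\<lambda>x. c)"
  and smooth_on_inner: "open A \<Longrightarrow> smooth_on A (\<lambda>x. x \<bullet> d)"
  and smooth_on_add: "open A \<Longrightarrow> smooth_on A f \<Longrightarrow> smooth_on A g \<Longrightarrow> smooth_on A (\<lambda>x. f x + g x)"
  and smooth_on_mult: "open A \<Longrightarrow> smooth_on A f \<Longrightarrow> smooth_on A g \<Longrightarrow> smooth_on A (\<lambda>x. f x * g x)"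
  unfolding smooth_on_def by (auto intro: Ck_on_const Ck_on_inner Ck_on_add Ck_on_mult)

lemma smooth_on_compose:
  fixes f :: "'b::euclidean_space \<Rightarrow> real" and T :: "'a::euclidean_space \<Rightarrow> 'b"
  assumes "open A" "T ` A \<subseteq> B" "smooth_on B f" "\<And>c. c \<in> Basis \<Longrightarrow> smooth_on A (\<lambda>x. T x \<bullet> c)"
  shows "smooth_on A (\<lambda>x. f (T x))"
  unfolding smooth_on_def
  by (rule allI, rule Ck_on_compose[OF assms(1,2)]) (use assms(3,4) in \<open>auto simp: smooth_on_def\<close>)

lemma smooth_on_compose_real:
  fixes f :: "real \<Rightarrow> real" and g :: "'a::euclidean_space \<Rightarrow> real"
  assumes "smooth_on J f" "open A" "g ` A \<subseteq> J" "smooth_on A g"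
  shows "smooth_on A (\<lambda>x. f (g x))"
  using smooth_on_compose[OF assms(2,3,1)] assms(4) by simp

lemma smooth_on_subset:
  fixes A :: "'a::euclidean_space set"
  assumes "smooth_on B f" "open A" "A \<subseteq> B"
  shows "smooth_on A f"
  using smooth_on_compose[of A "\<lambda>x. x" B f] assms smooth_on_inner[of A] by auto

lemma smooth_on_cong: "open A \<Longrightarrow> (\<And>y. y \<in> A \<Longrightarrow> f y = g y) \<Longrightarrow> smooth_on A f \<Longrightarrow> smooth_on A g"
  unfolding smooth_on_def using Ck_on_cong by blast

lemma smooth_on_exp: "smooth_on UNIV (exp :: real \<Rightarrow> real)"
proof -
  have "Ck_on k UNIV (exp :: real \<Rightarrow> real)" for k
  proof (induction k)
    case (Suc k)
    show ?case by (rule Ck_on_Suc_real[where f'=exp]) (use Suc in \<open>auto intro: DERIV_exp\<close>)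
  qed (auto intro: continuous_intros)
  then show ?thesis by (simp add: smooth_on_def)
qed

lemma smooth_on_sin: "smooth_on UNIV (sin :: real \<Rightarrow> real)"
  and smooth_on_cos: "smooth_on UNIV (cos :: real \<Rightarrow> real)"
proof -
  have "Ck_on k UNIV (sin :: real \<Rightarrow> real) \<and> Ck_on k UNIV (cos :: real \<Rightarrow> real)" for k
  proof (induction k)
    case (Suc k)
    have "Ck_on k UNIV (\<lambda>x::real. - 1 * sin x)"
      by (rule Ck_on_mult) (use Suc Ck_on_const in auto)
    then have "Ck_on k UNIV (\<lambda>x::real. - sin x)" by simp
    with Suc show ?case
      using Ck_on_Suc_real[OF open_UNIV, of sin cos] Ck_on_Suc_real[OF open_UNIV, of cos "\<lambda>x. - sin x"]
      by (auto intro!: derivative_eq_intros)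
  qed (auto intro: continuous_intros)
  then show "smooth_on UNIV (sin :: real \<Rightarrow> real)" "smooth_on UNIV (cos :: real \<Rightarrow> real)"
    by (simp_all add: smooth_on_def)
qed

lemma smooth_on_inverse: "smooth_on {0<..} (inverse :: real \<Rightarrow> real)"
proof -
  have "Ck_on k {0<..} (inverse :: real \<Rightarrow> real)" for k
  proof (induction k)
    case (Suc k)
    have "Ck_on k {0<..} (\<lambda>x::real. - 1 * (inverse x * inverse x))"
      by (intro Ck_on_mult Suc Ck_on_const) auto
    then show ?case
      by (intro Ck_on_Suc_real[where f'="\<lambda>x. - 1 * (inverse x * inverse x)"])
        (auto intro!: derivative_eq_intros)
  qed (auto intro!: continuous_intros)
  then show ?thesis by (simp add: smooth_on_def)
qed

text \<open>Smoothness of a primitive, which reduces the logarithm and the arc tangent to rational functions.\<close>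

lemma smooth_on_realI:
  fixes f f' :: "real \<Rightarrow> real"
  assumes "open J" "\<And>x. x \<in> J \<Longrightarrow> (f has_real_derivative f' x) (at x)" "smooth_on J f'"
  shows "smooth_on J f"
  using Ck_on_Suc_real[OF assms(1,2)] assms(3) Ck_on_Suc_imp unfolding smooth_on_def by blast

lemma smooth_on_ln: "smooth_on {0<..} (ln :: real \<Rightarrow> real)"
  by (rule smooth_on_realI[where f'=inverse]) (auto intro: smooth_on_inverse DERIV_ln)

lemma smooth_on_arctan: "smooth_on UNIV arctan"
proof (rule smooth_on_realI[OF open_UNIV DERIV_arctan])
  have id: "smooth_on UNIV (\<lambda>x::real. x)" using smooth_on_inner[of UNIV "1::real"] by simp
  have "smooth_on UNIV (\<lambda>x::real. inverse (1 + x * x))"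
    by (rule smooth_on_compose_real[OF smooth_on_inverse])
      (auto intro!: smooth_on_add smooth_on_mult smooth_on_const id add_pos_nonneg)
  then show "smooth_on UNIV (\<lambda>x::real. inverse (1 + x\<^sup>2))" by (simp add: power2_eq_square)
qed

section \<open>Test functions\<close>

lemma test_function_smooth: "\<phi> \<in> test_functions \<Omega> \<Longrightarrow> smooth_on UNIV \<phi>"
  by (simp add: test_functions_def smooth_on_def C_k_iff_Ck_on)

text \<open>The sets \<open>\<Omega>\<close> and \<open>- K\<close> form an open cover of the whole space; \<open>\<phi>\<close> is smooth on the first and zero on
the second, and smoothness is local.\<close>

lemma test_functionI:
  assumes "open \<Omega>" "smooth_on \<Omega> \<phi>" "compact K" "K \<subseteq> \<Omega>" "\<And>x. x \<notin> K \<Longrightarrow> \<phi> x = 0"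
  shows "\<phi> \<in> test_functions \<Omega>"
proof -
  have sub: "closure {x. \<phi> x \<noteq> 0} \<subseteq> K"
    using assms(3,5) compact_imp_closed by (intro closure_minimal) auto
  have cp: "compact (closure {x. \<phi> x \<noteq> 0})"
    using assms(3) sub by (meson compact_closure compact_imp_bounded bounded_subset closure_subset order_trans)
  have oK: "open (- K)" using assms(3) by (simp add: compact_imp_closed open_Compl)
  \<comment> \<open>Smoothness on the two members of the cover gives smoothness everywhere.\<close>
  have "Ck_on k UNIV f" if "Ck_on k \<Omega> f" "Ck_on k (- K) f" for k and f :: "'a \<Rightarrow> real"
    using that
  proof (induction k arbitrary: f)
    case 0
    have "continuous_on (\<Omega> \<union> - K) f" using 0 assms(1) oK by (intro continuous_on_open_Un) auto
    moreover have "\<Omega> \<union> - K = UNIV" using assms(4) by auto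
    ultimately show ?case by simp
  next
    case (Suc k)
    then show ?case using assms(4) by simp blast
  qed
  moreover have "Ck_on k (- K) \<phi>" for k
    using Ck_on_cong[OF oK, of "\<lambda>x. 0" \<phi>] Ck_on_const[OF oK, of k 0] assms(5) by auto
  ultimately show ?thesis
    using assms(2) sub cp assms(4) by (auto simp: test_functions_def C_k_iff_Ck_on smooth_on_def)
qed

lemma test_function_support:
  assumes "\<phi> \<in> test_functions \<Omega>"
  shows "\<exists>K. compact K \<and> K \<subseteq> \<Omega> \<and> (\<forall>x. x \<notin> K \<longrightarrow> \<phi> x = 0)
    \<and> (\<forall>x b. x \<notin> K \<longrightarrow> partial_deriv b \<phi> x = 0)"
proof (intro exI conjI allI impI)
  let ?K = "closure {x. \<phi> x \<noteq> 0}"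
  show "compact ?K" "?K \<subseteq> \<Omega>" using assms by (auto simp: test_functions_def)
  show z: "\<phi> x = 0" if "x \<notin> ?K" for x using closure_subset[of "{x. \<phi> x \<noteq> 0}"] that by blast
  show "partial_deriv b \<phi> x = 0" if "x \<notin> ?K" for x b
  proof -
    have "partial_deriv b \<phi> x = partial_deriv b (\<lambda>x. 0) x"
    proof (rule partial_deriv_cong)
      show "open (- ?K)" "x \<in> - ?K" using that by auto
      show "\<phi> y = 0" if "y \<in> - ?K" for y using z[of y] that by blast
    qed
    then show ?thesis using partial_deriv_eqI[OF has_derivative_const] by simp
  qed
qed

text \<open>A diffeomorphism transports test functions: \<open>R ` K\<close> is compact for every compact \<open>K\<close> because the
inverse \<open>R\<close> of \<open>T\<close> is continuous.\<close>

lemma test_function_pullback: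
  fixes T :: "'a::euclidean_space \<Rightarrow> 'b::euclidean_space"
  assumes "open A" "open B" "T ` A \<subseteq> B" "R ` B \<subseteq> A"
    "\<And>x. x \<in> A \<Longrightarrow> R (T x) = x" "continuous_on B R"
    "\<And>c. c \<in> Basis \<Longrightarrow> smooth_on A (\<lambda>x. T x \<bullet> c)"
    and \<phi>: "\<phi> \<in> test_functions B"
  shows "(\<lambda>x. if x \<in> A then \<phi> (T x) else 0) \<in> test_functions A"
proof -
  obtain K where K: "compact K" "K \<subseteq> B" "\<forall>x. x \<notin> K \<longrightarrow> \<phi> x = 0"
    using test_function_support[OF \<phi>] by blast
  show ?thesis
  proof (rule test_functionI[OF assms(1)])
    show "compact (R ` K)" using K assms(6) by (meson compact_continuous_image continuous_on_subset)
    show "R ` K \<subseteq> A" using K assms(4) by blast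
    show "(if x \<in> A then \<phi> (T x) else 0) = 0" if "x \<notin> R ` K" for x
      using that K(3)[rule_format, of "T x"] assms(5)[of x] by (metis imageI)
    have "smooth_on A (\<lambda>x. \<phi> (T x))"
      by (rule smooth_on_compose[OF assms(1) _ test_function_smooth[OF \<phi>]]) (use assms(7) in auto)
    then show "smooth_on A (\<lambda>x. if x \<in> A then \<phi> (T x) else 0)"
      by (rule smooth_on_cong[OF assms(1), rotated]) simp
  qed
qed

section \<open>Integration by parts\<close>

lemma integrable_continuous_compact_support:
  fixes f :: "'a::euclidean_space \<Rightarrow> real"
  assumes "continuous_on UNIV f" "compact K" "\<And>x. x \<notin> K \<Longrightarrow> f x = 0"
  shows "integrable lborel f"
proof -
  have "integrable lborel (\<lambda>x. indicator K x *\<^sub>R f x)"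
    by (rule borel_integrable_compact[OF assms(2)]) (rule continuous_on_subset[OF assms(1)], simp)
  moreover have "(\<lambda>x. indicator K x *\<^sub>R f x) = f"
    using assms(3) by (auto simp: indicator_def fun_eq_iff)
  ultimately show ?thesis by simp
qed

lemma has_real_derivative_along_line:
  fixes F :: "'a::euclidean_space \<Rightarrow> real"
  assumes "F differentiable at (x + s *\<^sub>R b)"
  shows "((\<lambda>s. F (x + s *\<^sub>R b)) has_real_derivative partial_deriv b F (x + s *\<^sub>R b)) (at s)"
proof -
  let ?D = "frechet_derivative F (at (x + s *\<^sub>R b))"
  have d: "(F has_derivative ?D) (at (x + s *\<^sub>R b))"
    using assms frechet_derivative_works by blast
  have "((\<lambda>s. x + s *\<^sub>R b) has_derivative (\<lambda>h. h *\<^sub>R b)) (at s)"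
    by (auto intro!: derivative_eq_intros)
  then have "((\<lambda>s. F (x + s *\<^sub>R b)) has_derivative (\<lambda>h. ?D (h *\<^sub>R b))) (at s)"
    using d by (rule has_derivative_compose)
  moreover have "?D (h *\<^sub>R b) = partial_deriv b F (x + s *\<^sub>R b) * h" for h
    using linear_scale[OF has_derivative_linear[OF d], of h b] by (simp add: partial_deriv_def)
  ultimately show ?thesis by (simp add: has_field_derivative_def)
qed

text \<open>By translation invariance of Lebesgue measure every difference quotient of \<open>F\<close> in the direction \<open>b\<close>
has integral zero. The quotients converge to the partial derivative, and the mean value theorem
dominates them by a multiple of the indicator of a large ball.\<close>

lemma integral_partial_deriv_eq_0:
  fixes F :: "'a::euclidean_space \<Rightarrow> real"
  assumes diff: "\<And>x. F differentiable at x" and cont: "continuous_on UNIV (partial_deriv b F)"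
    and K: "compact K" "\<And>x. x \<notin> K \<Longrightarrow> F x = 0"
  shows "integral\<^sup>L lborel (partial_deriv b F) = 0"
proof -
  have contF: "continuous_on UNIV F"
    using diff by (simp add: continuous_at_imp_continuous_on differentiable_imp_continuous_within)
  have z: "partial_deriv b F x = 0" if "x \<notin> K" for x
  proof -
    have "partial_deriv b F x = partial_deriv b (\<lambda>x. 0) x"
      by (rule partial_deriv_cong[of "- K"]) (use K that compact_imp_closed in auto)
    then show ?thesis using partial_deriv_eqI[OF has_derivative_const] by simp
  qed
  have "compact (partial_deriv b F ` K)"
    using K(1) cont by (meson compact_continuous_image continuous_on_subset subset_UNIV)
  then obtain M0 where M0: "\<And>y. y \<in> partial_deriv b F ` K \<Longrightarrow> norm y \<le> M0"
    using bounded_iff compact_imp_bounded by metis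
  define M where "M = max M0 0"
  have M: "\<bar>partial_deriv b F x\<bar> \<le> M" for x
    using M0[of "partial_deriv b F x"] z[of x] by (cases "x \<in> K") (auto simp: M_def)
  obtain r where r: "\<And>x. x \<in> K \<Longrightarrow> norm x \<le> r"
    using bounded_iff compact_imp_bounded[OF K(1)] by metis
  \<comment> \<open>All increments are at most \<open>b\<close> long, so this ball contains the supports of all the quotients.\<close>
  define B where "B = cball (0::'a) (r + norm b)"
  define s where "s n = inverse (real (Suc n))" for n
  have s: "0 < s n" "s n \<le> 1" for n by (auto simp: s_def field_simps)
  have s0: "s \<longlonglongrightarrow> 0" unfolding s_def by (rule LIMSEQ_inverse_real_of_nat)
  define D where "D n x = (F (x + s n *\<^sub>R b) - F x) / s n" for n x
  have intF: "integrable lborel F" by (rule integrable_continuous_compact_support[OF contF K])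
  have trans: "integrable lborel (\<lambda>x. F (x + c))"
      "integral\<^sup>L lborel (\<lambda>x. F (x + c)) = integral\<^sup>L lborel F" for c
  proof -
    have "integrable (distr lborel borel ((+) c)) F"
      using intF by (simp add: lborel_distr_plus)
    then show "integrable lborel (\<lambda>x. F (x + c))"
      by (subst (asm) integrable_distr_eq) (use contF in \<open>auto simp: add.commute intro: borel_measurable_continuous_onI\<close>)
    have "integral\<^sup>L lborel F = integral\<^sup>L (distr lborel borel ((+) c)) F"
      by (simp add: lborel_distr_plus)
    also have "\<dots> = integral\<^sup>L lborel (\<lambda>x. F (x + c))"
      by (subst integral_distr) (use contF in \<open>auto simp: add.commute intro: borel_measurable_continuous_onI\<close>)
    finally show "integral\<^sup>L lborel (\<lambda>x. F (x + c)) = integral\<^sup>L lborel F" ..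
  qed
  have D0: "integral\<^sup>L lborel (D n) = 0" for n
    unfolding D_def using trans(1)[of "s n *\<^sub>R b"] intF by (simp add: trans(2))
  have Db: "\<bar>D n x\<bar> \<le> M * indicator B x" for n x
  proof (cases "x \<in> B")
    case True
    obtain t where "F (x + s n *\<^sub>R b) - F (x + 0 *\<^sub>R b) = (s n - 0) * partial_deriv b F (x + t *\<^sub>R b)"
      using MVT2[OF s(1)[of n], of "\<lambda>s. F (x + s *\<^sub>R b)" "\<lambda>s. partial_deriv b F (x + s *\<^sub>R b)"]
        has_real_derivative_along_line[OF diff] by blast
    then have "D n x = partial_deriv b F (x + t *\<^sub>R b)" using s(1)[of n] by (simp add: D_def)
    then show ?thesis using M True by simp
  next
    case False
    then have far: "norm x > r + norm b" by (simp add: B_def)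
    have "norm x \<le> norm (x + s n *\<^sub>R b) + norm (s n *\<^sub>R b)"
      using norm_triangle_ineq4[of "x + s n *\<^sub>R b" "s n *\<^sub>R b"] by simp
    also have "norm (s n *\<^sub>R b) \<le> norm b" using s[of n] by (simp add: mult_left_le_one_le)
    finally have "norm (x + s n *\<^sub>R b) > r" using far by simp
    moreover have "norm x > r" using far norm_ge_zero[of b] by linarith
    ultimately have "x + s n *\<^sub>R b \<notin> K" "x \<notin> K" using r by force+
    then show ?thesis using K(2) False by (simp add: D_def)
  qed
  have lim: "(\<lambda>n. D n x) \<longlonglongrightarrow> partial_deriv b F x" for x
  proof -
    have "((\<lambda>h. (F (x + (0 + h) *\<^sub>R b) - F (x + 0 *\<^sub>R b)) / h) \<longlongrightarrow> partial_deriv b F (x + 0 *\<^sub>R b)) (at 0)"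
      using has_real_derivative_along_line[where x=x and s=0 and b=b, OF diff] unfolding DERIV_def by simp
    moreover have "filterlim s (at 0) sequentially"
      unfolding filterlim_at using s0 s(1) by (auto simp: less_imp_neq[symmetric] intro!: always_eventually dest: less_imp_neq)
    ultimately have "(\<lambda>n. (F (x + (0 + s n) *\<^sub>R b) - F (x + 0 *\<^sub>R b)) / s n)
        \<longlonglongrightarrow> partial_deriv b F (x + 0 *\<^sub>R b)"
      by (rule filterlim_compose)
    then show ?thesis by (simp add: D_def)
  qed
  have intB: "integrable lborel (\<lambda>x. M * indicator B x)"
    by (intro integrable_mult_right integrable_real_indicator)
      (use emeasure_bounded_finite[OF bounded_cball] in \<open>simp_all add: B_def less_top\<close>)
  have "(\<lambda>n. integral\<^sup>L lborel (D n)) \<longlonglongrightarrow> integral\<^sup>L lborel (partial_deriv b F)"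
  proof (rule integral_dominated_convergence[where w="\<lambda>x. M * indicator B x"])
    show "partial_deriv b F \<in> borel_measurable lborel" using cont by (auto intro: borel_measurable_continuous_onI)
    have "continuous_on UNIV (D n)" for n
      unfolding D_def using s(1)[of n]
      by (auto intro!: continuous_intros continuous_on_compose2[OF contF])
    then show "D n \<in> borel_measurable lborel" for n by (auto intro: borel_measurable_continuous_onI)
  qed (use intB lim Db in auto)
  then show ?thesis using D0 LIMSEQ_unique[OF _ tendsto_const] by simp
qed

lemma partial_deriv_mult:
  assumes "f differentiable at x" "g differentiable at x"
  shows "partial_deriv b (\<lambda>x. f x * g x) x = f x * partial_deriv b g x + partial_deriv b f x * g x"
  using partial_deriv_eqI[OF has_derivative_mult[OF
      assms[unfolded frechet_derivative_works]], of b] by (simp add: partial_deriv_def)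

lemma integral_by_parts_partial_deriv:
  fixes f g :: "'a::euclidean_space \<Rightarrow> real"
  assumes "\<And>x. f differentiable at x" "\<And>x. g differentiable at x"
    and cf: "continuous_on UNIV (partial_deriv b f)" and cg: "continuous_on UNIV (partial_deriv b g)"
    and K: "compact K" "\<And>x. x \<notin> K \<Longrightarrow> f x = 0" "\<And>x. x \<notin> K \<Longrightarrow> partial_deriv b f x = 0"
  shows "integral\<^sup>L lborel (\<lambda>x. f x * partial_deriv b g x)
       = - integral\<^sup>L lborel (\<lambda>x. partial_deriv b f x * g x)"
proof -
  have [continuous_intros]: "continuous_on UNIV f" "continuous_on UNIV g"
    using assms(1,2) by (simp_all add: continuous_at_imp_continuous_on differentiable_imp_continuous_within)
  have eq: "partial_deriv b (\<lambda>x. f x * g x) = (\<lambda>x. f x * partial_deriv b g x + partial_deriv b f x * g x)"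
    using assms(1,2) by (auto simp: partial_deriv_mult)
  have "integral\<^sup>L lborel (partial_deriv b (\<lambda>x. f x * g x)) = 0"
    by (rule integral_partial_deriv_eq_0[OF _ _ K(1)])
      (use assms in \<open>auto simp: eq intro!: continuous_intros cf cg\<close>)
  moreover have "integrable lborel (\<lambda>x. f x * partial_deriv b g x)"
      "integrable lborel (\<lambda>x. partial_deriv b f x * g x)"
    by (rule integrable_continuous_compact_support[OF _ K(1)];
        auto intro!: continuous_intros cf cg simp: K)+
  ultimately show ?thesis unfolding eq by simp
qed

section \<open>Test functions in the Sobolev space\<close>

lemma test_function_differentiable: "\<phi> \<in> test_functions \<Omega> \<Longrightarrow> \<phi> differentiable at x"
  and test_function_partial_continuous:
    "\<phi> \<in> test_functions \<Omega> \<Longrightarrow> b \<in> Basis \<Longrightarrow> continuous_on UNIV (partial_deriv b \<phi>)"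
  and test_function_continuous: "\<phi> \<in> test_functions \<Omega> \<Longrightarrow> continuous_on UNIV \<phi>"
proof -
  assume \<phi>: "\<phi> \<in> test_functions \<Omega>"
  then have "C_k 0 \<phi>" "C_k (Suc 0) \<phi>" unfolding test_functions_def by blast+
  then show "\<phi> differentiable at x" "continuous_on UNIV \<phi>"
    "b \<in> Basis \<Longrightarrow> continuous_on UNIV (partial_deriv b \<phi>)" by auto
qed

lemma nn_integral_lebesgue_on_eq_lborel:
  fixes f :: "'a::euclidean_space \<Rightarrow> ennreal"
  assumes "\<Omega> \<in> sets lebesgue" "\<And>x. x \<notin> \<Omega> \<Longrightarrow> f x = 0"
  shows "integral\<^sup>N (lebesgue_on \<Omega>) f = integral\<^sup>N lborel f"
proof -
  have "integral\<^sup>N (lebesgue_on \<Omega>) f = (\<integral>\<^sup>+x. f x * indicator \<Omega> x \<partial>lebesgue)"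
    using assms(1) by (intro nn_integral_restrict_space) simp
  also have "(\<lambda>x. f x * indicator \<Omega> x) = f" using assms(2) by (auto simp: fun_eq_iff indicator_def)
  finally show ?thesis by (simp add: nn_integral_completion)
qed

lemma integral_lebesgue_on_eq_lborel:
  fixes f :: "'a::euclidean_space \<Rightarrow> real"
  assumes "\<Omega> \<in> sets lebesgue" "\<And>x. x \<notin> \<Omega> \<Longrightarrow> f x = 0" "f \<in> borel_measurable borel"
  shows "integral\<^sup>L (lebesgue_on \<Omega>) f = integral\<^sup>L lborel f"
proof -
  have "(\<lambda>x. if x \<in> \<Omega> then f x else 0) = f" using assms(2) by auto
  then have "integral\<^sup>L (lebesgue_on \<Omega>) f = integral\<^sup>L lebesgue f"
    using Lebesgue_Measure.integral_restrict_UNIV[OF assms(1), of f] by simp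
  then show ?thesis using assms(3) by (simp add: integral_completion)
qed

lemma grad_inner_Basis: "b \<in> Basis \<Longrightarrow> grad f x \<bullet> b = partial_deriv b f x"
  by (simp add: grad_def inner_sum_left inner_Basis if_distrib sum.delta cong: if_cong)

lemma norm_grad_sq: "(norm (grad f x))\<^sup>2 = (\<Sum>b\<in>Basis. (partial_deriv b f x)\<^sup>2)"
  by (subst power2_norm_eq_inner, subst euclidean_inner)
    (simp add: grad_inner_Basis power2_eq_square)

lemma grad_test_continuous: "\<phi> \<in> test_functions \<Omega> \<Longrightarrow> continuous_on UNIV (grad \<phi>)"
  unfolding grad_def by (intro continuous_intros test_function_partial_continuous) auto

lemma continuous_compact_support_L2:
  fixes f :: "'a::euclidean_space \<Rightarrow> 'b::euclidean_space"
  assumes "\<Omega> \<in> sets lebesgue" "K \<subseteq> \<Omega>" "continuous_on UNIV f" "compact K" "\<And>x. x \<notin> K \<Longrightarrow> f x = 0"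
  shows "f \<in> L2 \<Omega>"
proof -
  have "f \<in> borel_measurable borel" using assms(3) by (rule borel_measurable_continuous_onI)
  then have m: "f \<in> borel_measurable (lebesgue_on \<Omega>)"
    by (simp add: measurable_completion measurable_restrict_space1)
  have "integrable lborel (\<lambda>x. (norm (f x))\<^sup>2)"
    by (rule integrable_continuous_compact_support[OF _ assms(4)])
      (auto intro!: continuous_intros assms(3) simp: assms(5))
  then have "(\<integral>\<^sup>+x. ennreal ((norm (f x))\<^sup>2) \<partial>lborel) < \<infinity>"
    by (simp add: integrable_iff_bounded)
  moreover have "L2_sq \<Omega> f = (\<integral>\<^sup>+x. ennreal ((norm (f x))\<^sup>2) \<partial>lborel)"
    unfolding L2_sq_def by (rule nn_integral_lebesgue_on_eq_lborel[OF assms(1)]) (use assms(2,5) in auto)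
  ultimately show ?thesis using m by (simp add: L2_def)
qed

lemma test_function_in_W12_0:
  fixes u :: "'a::euclidean_space \<Rightarrow> real"
  assumes "open \<Omega>" and u: "u \<in> test_functions \<Omega>"
  shows "(u, grad u) \<in> W12_0 \<Omega>"
proof -
  have \<Omega>: "\<Omega> \<in> sets lebesgue" using assms(1) by auto
  obtain K where K: "compact K" "K \<subseteq> \<Omega>" "\<forall>x. x \<notin> K \<longrightarrow> u x = 0"
      "\<forall>x b. x \<notin> K \<longrightarrow> partial_deriv b u x = 0"
    using test_function_support[OF u] by blast
  have g0: "grad u x = 0" if "x \<notin> K" for x using K(4) that by (simp add: grad_def)
  have "u \<in> L2 \<Omega>" "grad u \<in> L2 \<Omega>"
    by (rule continuous_compact_support_L2[OF \<Omega> K(2) _ K(1)];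
        use K(3) g0 test_function_continuous[OF u] grad_test_continuous[OF u] in auto)+
  moreover have "has_weak_gradient \<Omega> u (grad u)"
    unfolding has_weak_gradient_def
  proof (intro ballI)
    fix \<phi> :: "'a \<Rightarrow> real" and b :: 'a assume \<phi>: "\<phi> \<in> test_functions \<Omega>" and b: "b \<in> Basis"
    note cont = test_function_continuous[OF u] test_function_continuous[OF \<phi>]
      test_function_partial_continuous[OF u b] test_function_partial_continuous[OF \<phi> b]
    have "(\<integral>x. u x * partial_deriv b \<phi> x \<partial>lebesgue_on \<Omega>) = (\<integral>x. u x * partial_deriv b \<phi> x \<partial>lborel)"
      by (rule integral_lebesgue_on_eq_lborel[OF \<Omega>])
        (use K(2,3) in \<open>auto intro!: borel_measurable_continuous_onI continuous_intros cont\<close>)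
    also have "\<dots> = - (\<integral>x. partial_deriv b u x * \<phi> x \<partial>lborel)"
      by (rule integral_by_parts_partial_deriv[OF _ _ _ _ K(1)])
        (use K cont test_function_differentiable[OF u] test_function_differentiable[OF \<phi>] in auto)
    also have "(\<integral>x. partial_deriv b u x * \<phi> x \<partial>lborel) = (\<integral>x. partial_deriv b u x * \<phi> x \<partial>lebesgue_on \<Omega>)"
      by (rule integral_lebesgue_on_eq_lborel[OF \<Omega>, symmetric])
        (use K(2,4) in \<open>auto intro!: borel_measurable_continuous_onI continuous_intros cont\<close>)
    finally show "(\<integral>x. u x * partial_deriv b \<phi> x \<partial>lebesgue_on \<Omega>)
        = - (\<integral>x. (grad u x \<bullet> b) * \<phi> x \<partial>lebesgue_on \<Omega>)" using b by (simp add: grad_inner_Basis)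
  qed
  ultimately have "(u, grad u) \<in> W12 \<Omega>" by (simp add: W12_def)
  moreover have "(\<lambda>n::nat. L2_sq \<Omega> (\<lambda>x. u x - u x) + L2_sq \<Omega> (\<lambda>x. grad u x - grad u x)) \<longlonglongrightarrow> 0"
    by (simp add: L2_sq_def)
  ultimately show ?thesis unfolding W12_0_def using u by (auto intro!: exI[of _ "\<lambda>n. u"])
qed

text \<open>Young's inequality; with \<open>\<epsilon>\<close> small it compares the energies of a function and of a close approximation
up to a factor near \<open>1\<close>.\<close>

lemma norm_sq_le_weighted:
  fixes a b :: "'a::real_inner"
  assumes "\<epsilon> > 0"
  shows "(norm b)\<^sup>2 \<le> (1 + \<epsilon>) * (norm a)\<^sup>2 + (1 + 1 / \<epsilon>) * (norm (a - b))\<^sup>2"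
proof -
  define c where "c = a - b"
  have b: "b = a - c" by (simp add: c_def)
  have "0 \<le> (norm (sqrt \<epsilon> *\<^sub>R a + (1 / sqrt \<epsilon>) *\<^sub>R c))\<^sup>2" by simp
  also have "\<dots> = \<epsilon> * (a \<bullet> a) + 2 * (a \<bullet> c) + (1 / \<epsilon>) * (c \<bullet> c)"
    using assms unfolding power2_norm_eq_inner
    by (simp add: inner_add_left inner_add_right inner_commute field_simps)
  finally show ?thesis
    unfolding b power2_norm_eq_inner
    by (simp add: inner_diff_left inner_diff_right inner_commute algebra_simps)
qed

text \<open>Approximating test functions have a subsequence that converges almost everywhere, so Fatou's lemma
controls the left-hand side from below, while the energies converge by the choice of the
approximation.\<close>

lemma W12_0_weighted_inequality:
  fixes P :: "'a::euclidean_space \<Rightarrow> real"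
  assumes "open \<Omega>" and P: "P \<in> borel_measurable borel" "\<And>x. 0 \<le> P x"
    and test: "\<And>\<phi>. \<phi> \<in> test_functions \<Omega> \<Longrightarrow>
      (\<integral>\<^sup>+x. ennreal (P x * (\<phi> x)\<^sup>2) \<partial>lebesgue_on \<Omega>) \<le> L2_sq \<Omega> (grad \<phi>)"
    and ug: "(u, g) \<in> W12_0 \<Omega>"
  shows "(\<integral>\<^sup>+x. ennreal (P x * (u x)\<^sup>2) \<partial>lebesgue_on \<Omega>) \<le> L2_sq \<Omega> g"
proof -
  let ?M = "lebesgue_on \<Omega>"
  obtain \<phi> where \<phi>: "\<And>n::nat. \<phi> n \<in> test_functions \<Omega>"
    and lim: "(\<lambda>n. L2_sq \<Omega> (\<lambda>x. u x - \<phi> n x) + L2_sq \<Omega> (\<lambda>x. g x - grad (\<phi> n) x)) \<longlonglongrightarrow> 0"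
    and u: "u \<in> L2 \<Omega>" and g: "g \<in> L2 \<Omega>"
    using ug unfolding W12_0_def W12_def by auto
  have borel[measurable]: "\<phi> n \<in> borel_measurable ?M" "grad (\<phi> n) \<in> borel_measurable ?M" for n
    using borel_measurable_continuous_onI[OF test_function_continuous[OF \<phi>]]
      borel_measurable_continuous_onI[OF grad_test_continuous[OF \<phi>]]
    by (simp_all add: measurable_completion measurable_restrict_space1)
  have [measurable]: "u \<in> borel_measurable ?M" "g \<in> borel_measurable ?M"
    using u g by (auto simp: L2_def)
  have [measurable]: "P \<in> borel_measurable ?M"
    using P(1) by (simp add: measurable_completion measurable_restrict_space1)
  have l1: "(\<lambda>n. L2_sq \<Omega> (\<lambda>x. u x - \<phi> n x)) \<longlonglongrightarrow> 0" and l2: "(\<lambda>n. L2_sq \<Omega> (\<lambda>x. g x - grad (\<phi> n) x)) \<longlonglongrightarrow> 0"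
    by (rule tendsto_sandwich[OF _ _ tendsto_const lim]; simp)+
  have "eventually (\<lambda>n. L2_sq \<Omega> (\<lambda>x. u x - \<phi> n x) < 1) sequentially"
    by (rule order_tendstoD(2)[OF l1]) simp
  then obtain N where N: "\<And>n. n \<ge> N \<Longrightarrow> L2_sq \<Omega> (\<lambda>x. u x - \<phi> n x) < 1"
    unfolding eventually_sequentially by blast
  \<comment> \<open>The shift by \<open>N\<close> makes every squared difference integrable.\<close>
  define d where "d n x = (u x - \<phi> (n + N) x)\<^sup>2" for n x
  have nnd: "(\<integral>\<^sup>+x. ennreal (d n x) \<partial>?M) = L2_sq \<Omega> (\<lambda>x. u x - \<phi> (n + N) x)" for n
    by (simp add: L2_sq_def d_def)
  have intd: "integrable ?M (d n)" for n
  proof (rule integrableI_bounded)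
    show "d n \<in> borel_measurable ?M" unfolding d_def by measurable
    have "(\<integral>\<^sup>+x. ennreal (norm (d n x)) \<partial>?M) = (\<integral>\<^sup>+x. ennreal (d n x) \<partial>?M)" by (simp add: d_def)
    also have "\<dots> < \<infinity>" using N[of "n + N"] by (auto simp: nnd intro: order_less_trans)
    finally show "(\<integral>\<^sup>+x. ennreal (norm (d n x)) \<partial>?M) < \<infinity>" .
  qed
  have "(\<lambda>n. \<integral>\<^sup>+x. ennreal (d n x) \<partial>?M) \<longlonglongrightarrow> 0"
    unfolding nnd using l1 by (rule LIMSEQ_ignore_initial_segment)
  moreover have "(\<integral>\<^sup>+x. ennreal (d n x) \<partial>?M) = ennreal (\<integral>x. norm (d n x) \<partial>?M)" for n
    using nn_integral_eq_integral[OF intd[of n]] by (simp add: d_def[abs_def])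
  ultimately have "(\<lambda>n. ennreal (\<integral>x. norm (d n x) \<partial>?M)) \<longlonglongrightarrow> ennreal 0" by simp
  then have "(\<lambda>n. \<integral>x. norm (d n x) \<partial>?M) \<longlonglongrightarrow> 0"
    by (subst (asm) tendsto_ennreal_iff) auto
  then obtain r where r: "strict_mono r" "AE x in ?M. (\<lambda>n. d (r n) x) \<longlonglongrightarrow> 0"
    using tendsto_L1_AE_subseq[where u=d, OF intd] by blast
  define \<psi> where "\<psi> n = \<phi> (r n + N)" for n
  have \<psi>: "\<psi> n \<in> test_functions \<Omega>" for n using \<phi> by (simp add: \<psi>_def)
  have [measurable]: "\<psi> n \<in> borel_measurable ?M" for n unfolding \<psi>_def by measurable
  have ae: "AE x in ?M. (\<lambda>n. \<psi> n x) \<longlonglongrightarrow> u x"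
    using r(2)
  proof eventually_elim
    case (elim x)
    then have "(\<lambda>n. sqrt (d (r n) x)) \<longlonglongrightarrow> sqrt 0" by (rule tendsto_real_sqrt)
    then have "(\<lambda>n. u x - \<psi> n x) \<longlonglongrightarrow> 0"
      by (simp add: d_def \<psi>_def tendsto_rabs_zero_iff)
    from tendsto_diff[OF tendsto_const[of "u x"] this] show ?case by simp
  qed
  have l2': "(\<lambda>n. L2_sq \<Omega> (\<lambda>x. g x - grad (\<psi> n) x)) \<longlonglongrightarrow> 0"
  proof -
    have "strict_mono (\<lambda>n. r n + N)" using r(1) by (simp add: strict_mono_def)
    from LIMSEQ_subseq_LIMSEQ[OF l2 this] show ?thesis by (simp add: o_def \<psi>_def)
  qed
  have fatou: "(\<integral>\<^sup>+x. ennreal (P x * (u x)\<^sup>2) \<partial>?M)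
      \<le> liminf (\<lambda>n. \<integral>\<^sup>+x. ennreal (P x * (\<psi> n x)\<^sup>2) \<partial>?M)"
  proof -
    have "(\<integral>\<^sup>+x. ennreal (P x * (u x)\<^sup>2) \<partial>?M) = (\<integral>\<^sup>+x. liminf (\<lambda>n. ennreal (P x * (\<psi> n x)\<^sup>2)) \<partial>?M)"
    proof (rule nn_integral_cong_AE)
      show "AE x in ?M. ennreal (P x * (u x)\<^sup>2) = liminf (\<lambda>n. ennreal (P x * (\<psi> n x)\<^sup>2))"
        using ae
      proof eventually_elim
        case (elim x)
        have "(\<lambda>n. ennreal (P x * (\<psi> n x)\<^sup>2)) \<longlonglongrightarrow> ennreal (P x * (u x)\<^sup>2)"
          by (intro tendsto_intros tendsto_ennrealI elim)
        then show ?case using lim_imp_Liminf[OF sequentially_bot] by metis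
      qed
    qed
    also have "\<dots> \<le> liminf (\<lambda>n. \<integral>\<^sup>+x. ennreal (P x * (\<psi> n x)\<^sup>2) \<partial>?M)"
      by (rule nn_integral_liminf) measurable
    finally show ?thesis .
  qed
  have key: "(\<integral>\<^sup>+x. ennreal (P x * (u x)\<^sup>2) \<partial>?M) \<le> ennreal (1 + \<epsilon>) * L2_sq \<Omega> g" if \<epsilon>: "\<epsilon> > 0" for \<epsilon>
  proof -
    have le: "(\<integral>\<^sup>+x. ennreal (P x * (\<psi> n x)\<^sup>2) \<partial>?M)
        \<le> ennreal (1 + \<epsilon>) * L2_sq \<Omega> g + ennreal (1 + 1 / \<epsilon>) * L2_sq \<Omega> (\<lambda>x. g x - grad (\<psi> n) x)" for n
    proof -
      have [measurable]: "grad (\<psi> n) \<in> borel_measurable ?M" unfolding \<psi>_def by measurable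
      have "L2_sq \<Omega> (grad (\<psi> n))
          \<le> (\<integral>\<^sup>+x. ennreal (1 + \<epsilon>) * ennreal ((norm (g x))\<^sup>2)
              + ennreal (1 + 1 / \<epsilon>) * ennreal ((norm (g x - grad (\<psi> n) x))\<^sup>2) \<partial>?M)"
        unfolding L2_sq_def
      proof (rule nn_integral_mono)
        fix x
        show "ennreal ((norm (grad (\<psi> n) x))\<^sup>2) \<le> ennreal (1 + \<epsilon>) * ennreal ((norm (g x))\<^sup>2)
              + ennreal (1 + 1 / \<epsilon>) * ennreal ((norm (g x - grad (\<psi> n) x))\<^sup>2)"
          using norm_sq_le_weighted[OF \<epsilon>, of "grad (\<psi> n) x" "g x"] \<epsilon>
          by (simp add: ennreal_mult[symmetric] ennreal_plus[symmetric] del: ennreal_plus)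
      qed
      also have "\<dots> = ennreal (1 + \<epsilon>) * L2_sq \<Omega> g + ennreal (1 + 1 / \<epsilon>) * L2_sq \<Omega> (\<lambda>x. g x - grad (\<psi> n) x)"
        unfolding L2_sq_def by (subst nn_integral_add) (auto simp: nn_integral_cmult)
      finally show ?thesis using test[OF \<psi>, of n] by (rule order_trans[rotated])
    qed
    have "(\<lambda>n. ennreal (1 + \<epsilon>) * L2_sq \<Omega> g + ennreal (1 + 1 / \<epsilon>) * L2_sq \<Omega> (\<lambda>x. g x - grad (\<psi> n) x))
        \<longlonglongrightarrow> ennreal (1 + \<epsilon>) * L2_sq \<Omega> g + ennreal (1 + 1 / \<epsilon>) * 0"
      by (rule tendsto_add[OF tendsto_const ennreal_tendsto_cmult[OF _ l2']]) simp
    note lim_imp_Liminf[OF sequentially_bot this]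
    moreover note order_trans[OF fatou Liminf_mono[OF always_eventually[OF allI[OF le]]]]
    ultimately show ?thesis by simp
  qed
  have "L2_sq \<Omega> g < \<infinity>" using g by (simp add: L2_def)
  then obtain G where G: "L2_sq \<Omega> g = ennreal G" "G \<ge> 0" by (cases "L2_sq \<Omega> g") auto
  have "(\<lambda>n. ennreal ((1 + inverse (real (Suc n))) * G)) \<longlonglongrightarrow> ennreal ((1 + 0) * G)"
    by (intro tendsto_ennrealI tendsto_intros LIMSEQ_inverse_real_of_nat)
  moreover have "(\<integral>\<^sup>+x. ennreal (P x * (u x)\<^sup>2) \<partial>?M) \<le> ennreal ((1 + inverse (real (Suc n))) * G)" for n
    using key[of "inverse (real (Suc n))"] G by (simp add: ennreal_mult)
  ultimately have "(\<integral>\<^sup>+x. ennreal (P x * (u x)\<^sup>2) \<partial>?M) \<le> ennreal ((1 + 0) * G)"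
    by (intro LIMSEQ_le_const) auto
  then show ?thesis using G by simp
qed

section \<open>The complex exponential on the plane\<close>

text \<open>The complex exponential and the principal logarithm on the right half-plane, in real coordinates.\<close>

definition cexp :: "real^2 \<Rightarrow> real^2" where
  "cexp w = vector [exp (w$1) * cos (w$2), exp (w$1) * sin (w$2)]"

definition clog :: "real^2 \<Rightarrow> real^2" where
  "clog x = vector [ln (x$1 * x$1 + x$2 * x$2) / 2, arctan (x$2 / x$1)]"

text \<open>Multiplication by the complex number \<open>a + i b\<close>.\<close>

definition conformal_map :: "real \<Rightarrow> real \<Rightarrow> real^2 \<Rightarrow> real^2" where
  "conformal_map a b h = vector [a * h$1 - b * h$2, b * h$1 + a * h$2]"

abbreviation right_half_plane :: "(real^2) set" where
  "right_half_plane \<equiv> {x. 0 < x$1}"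

lemma cexp_nth [simp]: "cexp w $ 1 = exp (w$1) * cos (w$2)" "cexp w $ 2 = exp (w$1) * sin (w$2)"
  by (simp_all add: cexp_def)

lemma clog_nth: "clog x $ 1 = ln (x$1 * x$1 + x$2 * x$2) / 2" "clog x $ 2 = arctan (x$2 / x$1)"
  by (simp_all add: clog_def)

lemma conformal_map_nth [simp]:
  "conformal_map a b h $ 1 = a * h$1 - b * h$2" "conformal_map a b h $ 2 = b * h$1 + a * h$2"
  by (simp_all add: conformal_map_def)

lemma Basis_real2: "(Basis :: (real^2) set) = {axis 1 1, axis 2 1}"
  by (auto simp: Basis_vec_def UNIV_2)

lemma axis_real2_neq: "axis 1 1 \<noteq> (axis 2 1 :: real^2)"
  by (simp add: axis_eq_axis)

lemma vec2_eq_iff: "(x :: real^2) = y \<longleftrightarrow> x$1 = y$1 \<and> x$2 = y$2"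
  by (simp add: vec_eq_iff forall_2)

lemma norm_real2_sq: "(norm (x :: real^2))\<^sup>2 = x$1 * x$1 + x$2 * x$2"
  unfolding power2_norm_eq_inner by (simp add: inner_vec_def sum_2)

lemma norm_cexp: "norm (cexp w) = exp (w$1)"
proof -
  have "(norm (cexp w))\<^sup>2 = (exp (w$1))\<^sup>2 * ((cos (w$2))\<^sup>2 + (sin (w$2))\<^sup>2)"
    by (simp only: norm_real2_sq cexp_nth) (simp only: power2_eq_square algebra_simps)
  then show ?thesis by (simp add: power2_eq_iff_nonneg)
qed

lemma clog_cexp:
  assumes "\<bar>w$2\<bar> < pi / 2"
  shows "clog (cexp w) = w"
proof -
  have "cexp w$1 * cexp w$1 + cexp w$2 * cexp w$2 = (exp (w$1))\<^sup>2"
    unfolding norm_real2_sq[symmetric] norm_cexp ..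
  also have "ln \<dots> = 2 * w$1" by (simp add: ln_realpow)
  finally have "clog (cexp w) $ 1 = w$1" unfolding clog_nth(1) by simp
  moreover have "clog (cexp w) $ 2 = w$2"
  proof -
    have "cexp w$2 / cexp w$1 = tan (w$2)" by (simp add: tan_def)
    then show ?thesis using assms unfolding clog_nth(2) by (simp only:) (rule arctan_tan, auto)
  qed
  ultimately show ?thesis by (simp add: vec2_eq_iff)
qed

lemma cexp_clog:
  assumes "0 < x$1"
  shows "cexp (clog x) = x"
proof -
  let ?r = "x$1 * x$1 + x$2 * x$2"
  have r: "?r > 0" using assms by (intro add_pos_nonneg) auto
  have e: "exp (ln ?r / 2) = sqrt ?r"
    using r by (simp add: ln_sqrt[symmetric])
  have q: "sqrt (1 + (x$2 / x$1)\<^sup>2) = sqrt ?r / x$1"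
  proof -
    have "1 + (x$2 / x$1)\<^sup>2 = ?r / (x$1)\<^sup>2" using assms by (simp add: field_simps power2_eq_square)
    then show ?thesis using assms by (simp add: real_sqrt_divide)
  qed
  show ?thesis
    using assms r by (simp add: vec2_eq_iff clog_nth e cos_arctan sin_arctan q)
qed

lemma has_derivative_cexp:
  "(cexp has_derivative conformal_map (cexp w$1) (cexp w$2)) (at w)"
proof (subst has_derivative_componentwise_within, intro ballI)
  fix i :: "real^2" assume "i \<in> Basis"
  then consider "i = axis 1 1" | "i = axis 2 1" by (auto simp: Basis_real2)
  then show "((\<lambda>x. cexp x \<bullet> i) has_derivative
      (\<lambda>x. conformal_map (cexp w$1) (cexp w$2) x \<bullet> i)) (at w)"
    by cases (auto simp: inner_axis intro!: derivative_eq_intros bounded_linear_vec_nth[THEN bounded_linear_imp_has_derivative] simp: algebra_simps fun_eq_iff)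
qed

lemma smooth_on_nth: "open A \<Longrightarrow> smooth_on A (\<lambda>x::real^2. x$i)"
  using smooth_on_inner[of A "axis i 1"] by (simp add: inner_axis)

lemma smooth_on_cexp: "c \<in> Basis \<Longrightarrow> smooth_on UNIV (\<lambda>w. cexp w \<bullet> c)"
  by (auto simp: Basis_real2 inner_axis intro!: smooth_on_mult smooth_on_nth
      smooth_on_compose_real[OF smooth_on_exp] smooth_on_compose_real[OF smooth_on_cos]
      smooth_on_compose_real[OF smooth_on_sin])

lemma open_right_half_plane: "open right_half_plane"
  by (intro open_Collect_less continuous_intros)

lemma smooth_on_clog:
  assumes "c \<in> Basis"
  shows "smooth_on right_half_plane (\<lambda>x. clog x \<bullet> c)"
proof -
  note o = open_right_half_plane
  have "smooth_on right_half_plane (\<lambda>x. ln (x$1 * x$1 + x$2 * x$2) * inverse 2)"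
    by (intro smooth_on_mult[OF o] smooth_on_compose_real[OF smooth_on_ln o] smooth_on_add[OF o]
        smooth_on_nth[OF o] smooth_on_const[OF o]) (auto intro: add_pos_nonneg)
  moreover have "smooth_on right_half_plane (\<lambda>x. arctan (x$2 * inverse (x$1)))"
  proof (rule smooth_on_compose_real[OF smooth_on_arctan o])
    have "smooth_on right_half_plane (\<lambda>x. inverse (x$1))"
      by (rule smooth_on_compose_real[OF smooth_on_inverse o _ smooth_on_nth[OF o]]) auto
    then show "smooth_on right_half_plane (\<lambda>x. x$2 * inverse (x$1))"
      by (rule smooth_on_mult[OF o smooth_on_nth[OF o]])
  qed simp
  ultimately show ?thesis
    using assms by (auto simp only: Basis_real2 insert_iff empty_iff inner_axis inner_real_def mult_1_right
        clog_nth divide_inverse)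
qed

lemma smooth_on_uminus: "open A \<Longrightarrow> smooth_on A f \<Longrightarrow> smooth_on A (\<lambda>x. - f x)"
  using smooth_on_mult[OF _ smooth_on_const[of A "-1"], of f] by simp

lemma continuous_on_components_smooth:
  fixes T :: "'a::euclidean_space \<Rightarrow> 'b::euclidean_space"
  assumes "\<And>c. c \<in> Basis \<Longrightarrow> smooth_on A (\<lambda>x. T x \<bullet> c)"
  shows "continuous_on A T"
proof (subst continuous_on_componentwise, intro ballI)
  fix c :: 'b assume "c \<in> Basis"
  then have "Ck_on 0 A (\<lambda>x. T x \<bullet> c)" using assms unfolding smooth_on_def by blast
  then show "continuous_on A (\<lambda>x. T x \<bullet> c)" by simp
qed

section \<open>The domain\<close>

definition strip :: "(real^2) set" where
  "strip = {w. w$1 < 0 \<and> \<bar>w$2\<bar> < pi / 4}"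

text \<open>These are \<open>psi w = exp (- exp w)\<close> and its inverse \<open>phi\<close> on \<open>Omega\<close>; \<open>jac\<close> is the squared modulus of
the complex derivative \<open>- exp w * psi w\<close>.\<close>

definition psi :: "real^2 \<Rightarrow> real^2" where "psi w = cexp (- cexp w)"
definition phi :: "real^2 \<Rightarrow> real^2" where "phi x = clog (- clog x)"
definition Omega :: "(real^2) set" where "Omega = psi ` strip"
definition jac :: "real^2 \<Rightarrow> real" where "jac w = (norm (cexp w) * norm (psi w))\<^sup>2"

lemma open_strip: "open strip"
  unfolding strip_def by (intro open_Collect_conj open_Collect_less continuous_intros)

lemma convex_strip: "convex strip"
proof -
  have "strip = {w. w$1 < 0} \<inter> {w. w$2 < pi/4} \<inter> {w. w$2 > - (pi/4)}"
    by (auto simp: strip_def)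
  moreover have "convex {w::real^2. w$1 < 0}" "convex {w::real^2. w$2 < pi/4}"
      "convex {w::real^2. w$2 > - (pi/4)}"
    using convex_halfspace_lt[of "axis 1 1 :: real^2" 0] convex_halfspace_lt[of "axis 2 1 :: real^2" "pi/4"]
      convex_halfspace_gt[of "- (pi/4)" "axis 2 1 :: real^2"] by (simp_all add: inner_axis')
  ultimately show ?thesis by (metis convex_Int)
qed

text \<open>The half-width \<open>pi / 4\<close> of the strip enters here: it keeps \<open>cos\<close> away from zero.\<close>

lemma cos_strip: "w \<in> strip \<Longrightarrow> 0 < cos (w$2)" "w \<in> strip \<Longrightarrow> 1 / 2 \<le> (cos (w$2))\<^sup>2"
proof -
  assume "w \<in> strip"
  then have w: "\<bar>w$2\<bar> < pi / 4" by (simp add: strip_def)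
  then show "0 < cos (w$2)" by (intro cos_gt_zero_pi) auto
  have "0 < cos (2 * w$2)" using w by (intro cos_gt_zero_pi) auto
  then show "1 / 2 \<le> (cos (w$2))\<^sup>2" by (simp add: cos_double_cos)
qed

text \<open>On the strip \<open>exp w\<close> lies in the right half-plane and has modulus below \<open>1 < pi / 2\<close>, so both
exponentials that make up \<open>psi\<close> are inverted by the principal logarithm.\<close>

lemma cexp_strip:
  assumes "w \<in> strip"
  shows "0 < cexp w$1" "\<bar>cexp w$2\<bar> < pi / 2"
proof -
  show "0 < cexp w$1" using cos_strip[OF assms] by simp
  have "\<bar>cexp w$2\<bar> = exp (w$1) * \<bar>sin (w$2)\<bar>" by (simp add: abs_mult)
  also have "\<dots> \<le> exp (w$1) * 1" by (intro mult_left_mono) auto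
  also have "\<dots> < 1" using assms by (simp add: strip_def)
  also have "1 < pi / 2" using pi_gt3 by simp
  finally show "\<bar>cexp w$2\<bar> < pi / 2" .
qed

lemma clog_psi: "w \<in> strip \<Longrightarrow> clog (psi w) = - cexp w"
  unfolding psi_def using cexp_strip(2)[of w] by (intro clog_cexp) simp

lemma phi_psi: "w \<in> strip \<Longrightarrow> phi (psi w) = w"
  unfolding phi_def by (simp add: clog_psi) (rule clog_cexp, auto simp: strip_def)

lemma psi_phi: "0 < x$1 \<Longrightarrow> 0 < (- clog x)$1 \<Longrightarrow> psi (phi x) = x"
  unfolding phi_def psi_def by (simp only: cexp_clog minus_minus)

lemma psi_nth1_pos: "w \<in> strip \<Longrightarrow> 0 < psi w$1"
  using cexp_strip(2)[of w] unfolding psi_def by (auto intro!: mult_pos_pos cos_gt_zero_pi)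

lemma smooth_on_psi: "c \<in> Basis \<Longrightarrow> smooth_on strip (\<lambda>w. psi w \<bullet> c)"
  unfolding psi_def
  by (rule smooth_on_compose[OF open_strip _ smooth_on_cexp])
    (auto intro!: smooth_on_uminus open_strip smooth_on_subset[OF smooth_on_cexp] simp: inner_minus_left)

lemma continuous_on_psi: "continuous_on strip psi"
  by (rule continuous_on_components_smooth[OF smooth_on_psi])

lemma continuous_on_clog: "continuous_on right_half_plane clog"
  by (rule continuous_on_components_smooth[OF smooth_on_clog])

text \<open>A description of the image by inequalities on the continuous inverse, from which openness is
immediate.\<close>

lemma Omega_eq: "Omega = {x \<in> right_half_plane. - clog x \<in> {y \<in> right_half_plane. clog y \<in> strip}}"
proof (intro equalityI subsetI)
  fix x assume "x \<in> Omega"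
  then obtain w where w: "w \<in> strip" "x = psi w" by (auto simp: Omega_def)
  then have "- clog x = cexp w" by (simp add: clog_psi)
  moreover have "clog (cexp w) \<in> strip" using w phi_psi[OF w(1)] by (simp add: phi_def clog_psi)
  ultimately show "x \<in> {x \<in> right_half_plane. - clog x \<in> {y \<in> right_half_plane. clog y \<in> strip}}"
    using psi_nth1_pos[OF w(1)] cexp_strip(1)[OF w(1)] w(2) by (simp only: mem_Collect_eq)
next
  fix x assume "x \<in> {x \<in> right_half_plane. - clog x \<in> {y \<in> right_half_plane. clog y \<in> strip}}"
  then have "0 < x$1" "0 < (- clog x)$1" "phi x \<in> strip" by (simp_all only: phi_def mem_Collect_eq)
  then have "psi (phi x) = x" "phi x \<in> strip" using psi_phi by blast+
  then show "x \<in> Omega" unfolding Omega_def by (metis imageI)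
qed

lemma phi_Omega: "x \<in> Omega \<Longrightarrow> phi x \<in> strip"
  by (auto simp: Omega_def phi_psi)

lemma psi_phi_Omega: "x \<in> Omega \<Longrightarrow> psi (phi x) = x"
  by (auto simp: Omega_def phi_psi)

lemma psi_strip: "w \<in> strip \<Longrightarrow> psi w \<in> Omega"
  by (auto simp: Omega_def)

lemma open_Omega: "open Omega"
proof -
  have "open {y \<in> right_half_plane. clog y \<in> strip}"
    using continuous_open_preimage[OF continuous_on_clog open_right_half_plane open_strip]
    by (simp add: vimage_def Int_def)
  moreover have "continuous_on right_half_plane (\<lambda>x. - clog x)"
    by (intro continuous_intros continuous_on_clog)
  ultimately have "open (right_half_plane \<inter> (\<lambda>x. - clog x) -` {y \<in> right_half_plane. clog y \<in> strip})"
    by (intro continuous_open_preimage open_right_half_plane)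
  then show ?thesis unfolding Omega_eq by (simp add: vimage_def Int_def)
qed

lemma smooth_on_phi: "c \<in> Basis \<Longrightarrow> smooth_on Omega (\<lambda>x. phi x \<bullet> c)"
  unfolding phi_def
proof (rule smooth_on_compose[OF open_Omega _ smooth_on_clog])
  have sub: "Omega \<subseteq> right_half_plane" unfolding Omega_eq by blast
  show "(\<lambda>x. - clog x) ` Omega \<subseteq> right_half_plane" unfolding Omega_eq by blast
  show "smooth_on Omega (\<lambda>x. - clog x \<bullet> d)" if "d \<in> Basis" for d
    using smooth_on_uminus[OF open_Omega smooth_on_subset[OF smooth_on_clog[OF that] open_Omega sub]]
    by (simp add: inner_minus_left)
qed

lemma continuous_on_phi: "continuous_on Omega phi"
  by (rule continuous_on_components_smooth[OF smooth_on_phi])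

lemma norm_psi: "norm (psi w) = exp (- (exp (w$1) * cos (w$2)))"
  by (simp add: psi_def norm_cexp)

lemma jac_pos: "0 < jac w"
  by (simp add: jac_def norm_cexp norm_psi)

lemma domain_set_Omega: "domain_set Omega"
proof -
  have "connected Omega" unfolding Omega_def
    by (rule connected_continuous_image[OF continuous_on_psi convex_connected[OF convex_strip]])
  moreover have "vector [-1, 0] \<in> strip" by (simp add: strip_def)
  ultimately show ?thesis using open_Omega by (auto simp: domain_set_def Omega_def)
qed

lemma Omega_subset_ball: "Omega \<subseteq> ball 0 1"
  using cos_strip(1) by (auto simp: Omega_def norm_psi)

text \<open>The supremum is approached along the axis \<open>p = 0\<close> of the strip as \<open>s \<longlonglongrightarrow> - \<infinity>\<close>.\<close>

lemma SUP_norm_Omega: "(SUP x\<in>Omega. norm x) = 1"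
proof (rule cSup_eq_non_empty)
  show "norm ` Omega \<noteq> {}" using domain_set_Omega by (simp add: domain_set_def)
  show "y \<le> 1" if "y \<in> norm ` Omega" for y using that Omega_subset_ball by force
  show "1 \<le> y" if "\<And>z. z \<in> norm ` Omega \<Longrightarrow> z \<le> y" for y
  proof -
    have "exp (- exp (- real (Suc n))) \<le> y" for n
    proof -
      have "vector [- real (Suc n), 0] \<in> strip" by (simp add: strip_def)
      then have "psi (vector [- real (Suc n), 0]) \<in> Omega" by (rule psi_strip)
      then have "norm (psi (vector [- real (Suc n), 0])) \<le> y" using that by blast
      then show ?thesis by (simp add: norm_psi)
    qed
    moreover have "(\<lambda>n. exp (- exp (- real (Suc n)))) \<longlonglongrightarrow> exp (- 0)"
    proof (intro tendsto_intros)
      show "(\<lambda>n. exp (- real (Suc n))) \<longlonglongrightarrow> 0"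
        by (intro filterlim_compose[OF exp_at_bot] filterlim_compose[OF filterlim_uminus_at_bot_at_top]
            filterlim_compose[OF filterlim_real_sequentially] filterlim_Suc)
    qed
    ultimately show ?thesis using LIMSEQ_le_const2 by fastforce
  qed
qed

definition hardy_weight :: "real^2 \<Rightarrow> real" where
  "hardy_weight x = 1 / ((norm x)\<^sup>2 * (ln (outer_radius Omega / norm x))\<^sup>2)"

text \<open>Since \<open>- log \<bar>psi w\<bar> = exp s * cos p\<close> and \<open>jac w = exp (2 s) * \<bar>psi w\<bar>\<^sup>2\<close>, the Hardy weight differs from
the reciprocal of the Jacobian only by the factor \<open>1 / (cos p)\<^sup>2\<close>.\<close>

lemma hardy_weight_psi:
  assumes "w \<in> strip"
  shows "hardy_weight (psi w) = 1 / (cos (w$2))\<^sup>2 / jac w"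
proof -
  have "ln (outer_radius Omega / norm (psi w)) = exp (w$1) * cos (w$2)"
    unfolding outer_radius_def SUP_norm_Omega norm_psi by (simp add: exp_minus[symmetric] ln_div)
  then show ?thesis
    unfolding hardy_weight_def jac_def by (simp add: norm_cexp power_mult_distrib field_simps)
qed

section \<open>Change of variables\<close>

text \<open>The substitution rule in the form used below, for functions on the whole plane that vanish off the
two sets.\<close>

lemma lborel_change_of_variables:
  fixes g :: "real^2 \<Rightarrow> real^2" and F G :: "real^2 \<Rightarrow> real"
  assumes "open S" "open (g ` S)" "\<And>w. w \<in> S \<Longrightarrow> (g has_derivative g' w) (at w)" "inj_on g S"
    and "integrable lborel F" "integrable lborel G"
    and "\<And>x. x \<notin> g ` S \<Longrightarrow> F x = 0" "\<And>w. w \<notin> S \<Longrightarrow> G w = 0"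
    and eq: "\<And>w. w \<in> S \<Longrightarrow> G w = \<bar>det (matrix (g' w))\<bar> * F (g w)"
  shows "integral\<^sup>L lborel G = integral\<^sup>L lborel F"
proof -
  have abs: "H absolutely_integrable_on A" "integral A H = integral\<^sup>L lborel H"
    if "integrable lborel H" "\<And>x. x \<notin> A \<Longrightarrow> H x = 0" for H :: "real^2 \<Rightarrow> real" and A
  proof -
    have "(\<lambda>x. indicator A x *\<^sub>R H x) = H" using that(2) by (auto simp: indicator_def fun_eq_iff)
    then show "H absolutely_integrable_on A"
      using that(1) by (simp add: set_integrable_def integrable_completion)
    have "(\<lambda>x. if x \<in> A then H x else 0) = H" using that(2) by auto
    then have "integral A H = integral UNIV H"
      using Henstock_Kurzweil_Integration.integral_restrict_UNIV[of A H] by simp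
    then show "integral A H = integral\<^sup>L lborel H" using integral_lborel[OF that(1)] by simp
  qed
  note F = abs[OF assms(5,7)] and G = abs[OF assms(6,8)]
  \<comment> \<open>Substitution is applied to \<open>F\<close> regarded as a map into one-dimensional Euclidean space.\<close>
  have v: "(\<lambda>x. vec (F x) :: real^1) absolutely_integrable_on g ` S"
    using F(1) by (simp add: absolutely_integrable_on_1_iff)
  have "(\<lambda>w. \<bar>det (matrix (g' w))\<bar> *\<^sub>R (vec (F (g w)) :: real^1)) absolutely_integrable_on S \<and>
      integral S (\<lambda>w. \<bar>det (matrix (g' w))\<bar> *\<^sub>R (vec (F (g w)) :: real^1)) = integral (g ` S) (\<lambda>x. vec (F x))"
    using has_absolute_integral_change_of_variables[of S g g' "\<lambda>x. vec (F x) :: real^1"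
        "integral (g ` S) (\<lambda>x. vec (F x))"] assms(1,3,4) v
    by (auto intro: has_derivative_at_withinI)
  then have "integral S (\<lambda>w. \<bar>det (matrix (g' w))\<bar> *\<^sub>R (vec (F (g w)) :: real^1)) $ 1
      = integral (g ` S) (\<lambda>x. vec (F x) :: real^1) $ 1"
    and ai: "(\<lambda>w. \<bar>det (matrix (g' w))\<bar> *\<^sub>R (vec (F (g w)) :: real^1)) absolutely_integrable_on S" by auto
  then have "integral S (\<lambda>w. \<bar>det (matrix (g' w))\<bar> * F (g w)) = integral (g ` S) F"
    by (simp add: integral_on_1_eq)
  moreover have "integral S (\<lambda>w. \<bar>det (matrix (g' w))\<bar> * F (g w)) = integral S G"
    by (rule integral_cong) (simp add: eq)
  ultimately show ?thesis using F(2) G(2) by simp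
qed

lemma det_conformal_map: "det (matrix (conformal_map a b)) = a * a + b * b"
  by (simp add: det_2 matrix_def axis_def)

text \<open>The chain rule gives the complex derivative \<open>- psi w * exp w\<close>.\<close>

lemma has_derivative_psi:
  obtains a b where "(psi has_derivative conformal_map a b) (at w)" "a * a + b * b = jac w"
proof
  let ?p1 = "cexp w$1" and ?p2 = "cexp w$2" and ?q1 = "psi w$1" and ?q2 = "psi w$2"
  let ?a = "?q2 * ?p2 - ?q1 * ?p1" and ?b = "- (?q2 * ?p1 + ?q1 * ?p2)"
  have "((\<lambda>w. - cexp w) has_derivative (\<lambda>h. - conformal_map ?p1 ?p2 h)) (at w)"
    by (intro derivative_intros has_derivative_cexp)
  then have "((\<lambda>w. cexp (- cexp w)) has_derivative
      (\<lambda>h. conformal_map (cexp (- cexp w)$1) (cexp (- cexp w)$2) (- conformal_map ?p1 ?p2 h))) (at w)"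
    by (rule has_derivative_compose[OF _ has_derivative_cexp])
  moreover have "(\<lambda>h. conformal_map (cexp (- cexp w)$1) (cexp (- cexp w)$2) (- conformal_map ?p1 ?p2 h))
      = conformal_map ?a ?b"
    unfolding psi_def[symmetric] by (auto simp: vec2_eq_iff fun_eq_iff algebra_simps simp del: cexp_nth)
  ultimately show "(psi has_derivative conformal_map ?a ?b) (at w)" by (simp add: psi_def[abs_def])
  have "jac w = (?p1 * ?p1 + ?p2 * ?p2) * (?q1 * ?q1 + ?q2 * ?q2)"
    unfolding jac_def power_mult_distrib norm_real2_sq ..
  moreover have "(q2 * p2 - q1 * p1) * (q2 * p2 - q1 * p1) + - (q2 * p1 + q1 * p2) * - (q2 * p1 + q1 * p2)
      = (p1 * p1 + p2 * p2) * (q1 * q1 + q2 * q2)" for p1 p2 q1 q2 :: real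
    by (simp add: algebra_simps)
  ultimately show "?a * ?a + ?b * ?b = jac w" by (simp only:)
qed

lemma psi_jacobian:
  "(psi has_derivative frechet_derivative psi (at w)) (at w)"
  "\<bar>det (matrix (frechet_derivative psi (at w)))\<bar> = jac w"
proof -
  obtain a b where d: "(psi has_derivative conformal_map a b) (at w)" and j: "a * a + b * b = jac w"
    by (rule has_derivative_psi)
  have f: "frechet_derivative psi (at w) = conformal_map a b" using frechet_derivative_at[OF d] ..
  show "(psi has_derivative frechet_derivative psi (at w)) (at w)" using d f by simp
  show "\<bar>det (matrix (frechet_derivative psi (at w)))\<bar> = jac w"
    unfolding f det_conformal_map j using jac_pos[of w] by simp
qed

lemma inj_on_psi: "inj_on psi strip"
  by (metis inj_onI phi_psi)

lemma continuous_extend_zero: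
  fixes f :: "'a::euclidean_space \<Rightarrow> real"
  assumes "open A" "continuous_on A f" "compact K" "K \<subseteq> A" "\<And>x. x \<in> A \<Longrightarrow> x \<notin> K \<Longrightarrow> f x = 0"
  shows "continuous_on UNIV (\<lambda>x. if x \<in> A then f x else 0)" (is "continuous_on UNIV ?f")
proof -
  have "continuous_on A ?f" using assms(2) by (simp cong: continuous_on_cong)
  moreover have "continuous_on (- K) ?f"
    by (rule continuous_on_eq[OF continuous_on_const[of _ 0]]) (use assms(5) in auto)
  ultimately have "continuous_on (A \<union> - K) ?f"
    using assms(1,3) by (intro continuous_on_open_Un) (auto simp: compact_imp_closed)
  moreover have "A \<union> - K = UNIV" using assms(4) by auto
  ultimately show ?thesis by simp
qed

lemma integrable_extend_zero:
  fixes f :: "'a::euclidean_space \<Rightarrow> real"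
  assumes "open A" "continuous_on A f" "compact K" "K \<subseteq> A" "\<And>x. x \<in> A \<Longrightarrow> x \<notin> K \<Longrightarrow> f x = 0"
  shows "integrable lborel (\<lambda>x. if x \<in> A then f x else 0)"
  using assms by (intro integrable_continuous_compact_support[OF continuous_extend_zero[OF assms] assms(3)]) auto

section \<open>Transfer between the domain and the strip\<close>

definition to_strip :: "(real^2 \<Rightarrow> real) \<Rightarrow> real^2 \<Rightarrow> real" where
  "to_strip u w = (if w \<in> strip then u (psi w) else 0)"

definition from_strip :: "(real^2 \<Rightarrow> real) \<Rightarrow> real^2 \<Rightarrow> real" where
  "from_strip U x = (if x \<in> Omega then U (phi x) else 0)"

lemma to_strip_test: "u \<in> test_functions Omega \<Longrightarrow> to_strip u \<in> test_functions strip"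
  unfolding to_strip_def[abs_def]
  by (rule test_function_pullback[OF open_strip open_Omega, where R = phi])
    (auto simp: psi_strip phi_Omega phi_psi intro: continuous_on_phi smooth_on_psi)

lemma from_strip_test: "U \<in> test_functions strip \<Longrightarrow> from_strip U \<in> test_functions Omega"
  unfolding from_strip_def[abs_def]
  by (rule test_function_pullback[OF open_Omega open_strip, where R = psi])
    (auto simp: psi_strip phi_Omega psi_phi_Omega intro: continuous_on_psi smooth_on_phi)

lemma test_function_zero: "u \<in> test_functions A \<Longrightarrow> x \<notin> A \<Longrightarrow> u x = 0"
  using test_function_support[of u A] by blast

lemma to_from_strip: "U \<in> test_functions strip \<Longrightarrow> to_strip (from_strip U) = U"
  by (auto simp: to_strip_def from_strip_def fun_eq_iff psi_strip phi_psi test_function_zero)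

abbreviation pd1 :: "(real^2 \<Rightarrow> real) \<Rightarrow> real^2 \<Rightarrow> real" where "pd1 \<equiv> partial_deriv (axis 1 1)"
abbreviation pd2 :: "(real^2 \<Rightarrow> real) \<Rightarrow> real^2 \<Rightarrow> real" where "pd2 \<equiv> partial_deriv (axis 2 1)"

lemma norm_grad_sq_real2: "(norm (grad f x))\<^sup>2 = (pd1 f x)\<^sup>2 + (pd2 f x)\<^sup>2"
  by (simp add: norm_grad_sq Basis_real2 axis_real2_neq)

lemma has_derivative_real2:
  assumes "f differentiable at (x::real^2)"
  shows "(f has_derivative (\<lambda>h. h$1 * pd1 f x + h$2 * pd2 f x)) (at x)"
  using has_derivative_partial_sum[OF assms] by (simp add: Basis_real2 axis_real2_neq inner_axis)

text \<open>Conformality: the transposed derivative of \<open>psi\<close> is a rotation followed by the dilation by \<open>sqrt (jac w)\<close>.\<close>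

lemma grad_to_strip:
  assumes u: "u \<in> test_functions Omega" and w: "w \<in> strip"
  shows "(norm (grad (to_strip u) w))\<^sup>2 = jac w * (norm (grad u (psi w)))\<^sup>2"
proof -
  obtain a b where d: "(psi has_derivative conformal_map a b) (at w)" and j: "a * a + b * b = jac w"
    by (rule has_derivative_psi)
  let ?x = "psi w"
  have "((\<lambda>w. u (psi w)) has_derivative
      (\<lambda>h. conformal_map a b h$1 * pd1 u ?x + conformal_map a b h$2 * pd2 u ?x)) (at w)"
    by (rule has_derivative_compose[OF d has_derivative_real2[OF test_function_differentiable[OF u]]])
  then have "(to_strip u has_derivative
      (\<lambda>h. conformal_map a b h$1 * pd1 u ?x + conformal_map a b h$2 * pd2 u ?x)) (at w)"
    by (rule has_derivative_transform_within_open[OF _ open_strip w]) (simp add: to_strip_def)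
  note p = partial_deriv_eqI[OF this]
  show ?thesis
    unfolding norm_grad_sq_real2 p j[symmetric]
    by (simp add: axis_def power2_eq_square algebra_simps)
qed

text \<open>Conformal invariance of the Dirichlet integral in two dimensions: the factor \<open>jac\<close> in the squared
gradient is the Jacobian determinant.\<close>

lemma energy_transfer:
  assumes u: "u \<in> test_functions Omega"
  shows "L2_sq Omega (grad u) = ennreal (\<integral>w. (norm (grad (to_strip u) w))\<^sup>2 \<partial>lborel)"
proof -
  let ?F = "\<lambda>x. (norm (grad u x))\<^sup>2" and ?G = "\<lambda>w. (norm (grad (to_strip u) w))\<^sup>2"
  have int: "integrable lborel (\<lambda>x. (norm (grad v x))\<^sup>2)" "\<And>x. x \<notin> A \<Longrightarrow> (norm (grad v x))\<^sup>2 = 0"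
    if v: "v \<in> test_functions A" for v :: "real^2 \<Rightarrow> real" and A
  proof -
    obtain K where K: "compact K" "K \<subseteq> A" "\<forall>x b. x \<notin> K \<longrightarrow> partial_deriv b v x = 0"
      using test_function_support[OF v] by blast
    then show "integrable lborel (\<lambda>x. (norm (grad v x))\<^sup>2)"
      by (intro integrable_continuous_compact_support[OF _ K(1)] continuous_intros grad_test_continuous[OF v])
        (simp add: norm_grad_sq_real2)
    show "(norm (grad v x))\<^sup>2 = 0" if "x \<notin> A" for x
      using K that by (auto simp: norm_grad_sq_real2)
  qed
  have eq: "integral\<^sup>L lborel ?G = integral\<^sup>L lborel ?F"
  proof (rule lborel_change_of_variables[OF open_strip _ _ inj_on_psi, where g' = "\<lambda>w. frechet_derivative psi (at w)"])
    show "open (psi ` strip)" using open_Omega by (simp add: Omega_def)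
    fix w :: "real^2" assume w: "w \<in> strip"
    show "(psi has_derivative frechet_derivative psi (at w)) (at w)" by (rule psi_jacobian)
    show "?G w = \<bar>det (matrix (frechet_derivative psi (at w)))\<bar> * ?F (psi w)"
      unfolding psi_jacobian grad_to_strip[OF u w] ..
  qed (use int[OF u] int[OF to_strip_test[OF u]] in \<open>auto simp: Omega_def\<close>)
  have "L2_sq Omega (grad u) = (\<integral>\<^sup>+x. ennreal (?F x) \<partial>lborel)"
    unfolding L2_sq_def by (rule nn_integral_lebesgue_on_eq_lborel) (use int(2)[OF u] open_Omega in auto)
  also have "\<dots> = ennreal (integral\<^sup>L lborel ?F)"
    by (rule nn_integral_eq_integral[OF int(1)[OF u]]) simp
  finally show ?thesis using eq by simp
qed

text \<open>The weight on \<open>Omega\<close> that corresponds to the potential \<open>Q\<close> on the strip. It is set to zero off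
\<open>Omega\<close> so that it is Borel measurable on the plane.\<close>

definition weight_on_Omega :: "(real^2 \<Rightarrow> real) \<Rightarrow> real^2 \<Rightarrow> real" where
  "weight_on_Omega Q x = (if x \<in> Omega then Q (phi x) / jac (phi x) else 0)"

lemma continuous_on_jac: "continuous_on A jac"
proof -
  have "continuous_on UNIV cexp" by (rule continuous_on_components_smooth[OF smooth_on_cexp])
  then have "continuous_on A cexp" "continuous_on A psi" unfolding psi_def
    by (auto intro!: continuous_intros continuous_on_compose2[of UNIV cexp] intro: continuous_on_subset)
  then show ?thesis unfolding jac_def by (intro continuous_intros)
qed

lemma continuous_on_weight_on_Omega:
  assumes "continuous_on strip Q"
  shows "continuous_on Omega (weight_on_Omega Q)"
proof -
  have "continuous_on Omega (\<lambda>x. Q (phi x) / jac (phi x))"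
    by (intro continuous_intros continuous_on_compose2[OF assms continuous_on_phi]
        continuous_on_compose2[OF continuous_on_jac continuous_on_phi])
      (use jac_pos phi_Omega in \<open>auto simp: less_imp_neq[symmetric]\<close>)
  then show ?thesis by (rule continuous_on_eq) (simp add: weight_on_Omega_def)
qed

lemma weight_on_Omega_borel:
  assumes "continuous_on strip Q"
  shows "weight_on_Omega Q \<in> borel_measurable borel"
proof -
  have "(\<lambda>x. indicator Omega x *\<^sub>R weight_on_Omega Q x) \<in> borel_measurable borel"
    using borel_measurable_continuous_on_indicator[OF _ continuous_on_weight_on_Omega[OF assms]] open_Omega by simp
  moreover have "(\<lambda>x. indicator Omega x *\<^sub>R weight_on_Omega Q x) = weight_on_Omega Q"
    by (auto simp: indicator_def weight_on_Omega_def fun_eq_iff)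
  ultimately show ?thesis by simp
qed

lemma integrable_weighted_test:
  fixes u :: "'a::euclidean_space \<Rightarrow> real"
  assumes "open A" "continuous_on A Q" and u: "u \<in> test_functions A"
  shows "integrable lborel (\<lambda>x. Q x * (u x)\<^sup>2)"
proof -
  obtain K where K: "compact K" "K \<subseteq> A" "\<forall>x. x \<notin> K \<longrightarrow> u x = 0"
    using test_function_support[OF u] by blast
  have "continuous_on A u" using test_function_continuous[OF u] continuous_on_subset by blast
  then have "integrable lborel (\<lambda>x. if x \<in> A then Q x * (u x)\<^sup>2 else 0)"
    using assms(2) K by (intro integrable_extend_zero[OF assms(1) _ K(1,2)] continuous_intros) auto
  moreover have "(\<lambda>x. if x \<in> A then Q x * (u x)\<^sup>2 else 0) = (\<lambda>x. Q x * (u x)\<^sup>2)"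
    using K by (auto simp: fun_eq_iff)
  ultimately show ?thesis by simp
qed

lemma weighted_transfer:
  assumes u: "u \<in> test_functions Omega" and Q: "continuous_on strip Q" "\<And>w. w \<in> strip \<Longrightarrow> 0 \<le> Q w"
  shows "(\<integral>\<^sup>+x. ennreal (weight_on_Omega Q x * (u x)\<^sup>2) \<partial>lebesgue_on Omega)
    = ennreal (\<integral>w. Q w * (to_strip u w)\<^sup>2 \<partial>lborel)"
proof -
  let ?F = "\<lambda>x. weight_on_Omega Q x * (u x)\<^sup>2" and ?G = "\<lambda>w. Q w * (to_strip u w)\<^sup>2"
  have intF: "integrable lborel ?F"
    by (rule integrable_weighted_test[OF open_Omega continuous_on_weight_on_Omega[OF Q(1)] u])
  have eq: "integral\<^sup>L lborel ?G = integral\<^sup>L lborel ?F"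
  proof (rule lborel_change_of_variables[OF open_strip _ _ inj_on_psi intF, where g' = "\<lambda>w. frechet_derivative psi (at w)"])
    show "open (psi ` strip)" using open_Omega by (simp add: Omega_def)
    show "integrable lborel ?G" by (rule integrable_weighted_test[OF open_strip Q(1) to_strip_test[OF u]])
    fix w :: "real^2" assume w: "w \<in> strip"
    show "(psi has_derivative frechet_derivative psi (at w)) (at w)" by (rule psi_jacobian)
    show "?G w = \<bar>det (matrix (frechet_derivative psi (at w)))\<bar> * ?F (psi w)"
      unfolding psi_jacobian using jac_pos[of w] w
      by (simp add: weight_on_Omega_def psi_strip phi_psi to_strip_def)
  qed (auto simp: Omega_def[symmetric] weight_on_Omega_def to_strip_def)
  have "(\<integral>\<^sup>+x. ennreal (?F x) \<partial>lebesgue_on Omega) = (\<integral>\<^sup>+x. ennreal (?F x) \<partial>lborel)"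
    by (rule nn_integral_lebesgue_on_eq_lborel) (use open_Omega in \<open>auto simp: weight_on_Omega_def\<close>)
  also have "\<dots> = ennreal (integral\<^sup>L lborel ?F)"
    by (rule nn_integral_eq_integral[OF intF])
      (use Q(2) phi_Omega jac_pos in \<open>auto simp: weight_on_Omega_def less_imp_le\<close>)
  finally show ?thesis using eq by simp
qed

section \<open>Hardy-type inequalities on the strip\<close>

lemma test_function_partial_integrals:
  fixes u :: "'a::euclidean_space \<Rightarrow> real"
  assumes u: "u \<in> test_functions A" and b: "b \<in> Basis"
  shows "integrable lborel (\<lambda>x. (partial_deriv b u x)\<^sup>2)" "integrable lborel (partial_deriv b u)"
    "integral\<^sup>L lborel (partial_deriv b u) = 0"
proof -
  obtain K where K: "compact K" "\<forall>x. x \<notin> K \<longrightarrow> u x = 0" "\<forall>x b. x \<notin> K \<longrightarrow> partial_deriv b u x = 0"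
    using test_function_support[OF u] by blast
  note c = test_function_partial_continuous[OF u b]
  show "integrable lborel (\<lambda>x. (partial_deriv b u x)\<^sup>2)" "integrable lborel (partial_deriv b u)"
    by (rule integrable_continuous_compact_support[OF _ K(1)]; use K(3) c in \<open>auto intro!: continuous_intros\<close>)+
  show "integral\<^sup>L lborel (partial_deriv b u) = 0"
    by (rule integral_partial_deriv_eq_0[OF test_function_differentiable[OF u] c K(1)]) (use K(2) in auto)
qed

text \<open>Expand the nonnegative square \<open>(\<partial>u + q u)\<^sup>2\<close> and recognise \<open>\<partial>(q u\<^sup>2)\<close>, whose integral vanishes: this leaves
the lower bound \<open>\<partial>q - q\<^sup>2\<close> for the energy. For a positive function \<open>h\<close> and \<open>q = - \<partial>h / h\<close> this quantity is
\<open>- \<partial>\<^sup>2h / h\<close>, so a good \<open>q\<close> comes from a positive solution \<open>h\<close> of the Euler equation of the desired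
inequality.\<close>

lemma picone_inequality:
  fixes u :: "'a::euclidean_space \<Rightarrow> real"
  assumes A: "open A" and b: "b \<in> Basis" and u: "u \<in> test_functions A" and q: "smooth_on A q"
    and c: "continuous_on A c" "\<And>x. x \<in> A \<Longrightarrow> c x \<le> partial_deriv b q x - (q x)\<^sup>2"
  shows "(\<integral>x. c x * (u x)\<^sup>2 \<partial>lborel) \<le> (\<integral>x. (partial_deriv b u x)\<^sup>2 \<partial>lborel)"
proof -
  obtain K where K: "compact K" "K \<subseteq> A" "\<forall>x. x \<notin> K \<longrightarrow> u x = 0" "\<forall>x b. x \<notin> K \<longrightarrow> partial_deriv b u x = 0"
    using test_function_support[OF u] by blast
  define F where "F x = (if x \<in> A then q x * (u x * u x) else 0)" for x
  have uA: "smooth_on A u" by (rule smooth_on_subset[OF test_function_smooth[OF u] A]) simp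
  have F: "F \<in> test_functions A"
  proof (rule test_functionI[OF A _ K(1,2)])
    have "smooth_on A (\<lambda>x. q x * (u x * u x))" by (intro smooth_on_mult A q uA)
    then show "smooth_on A F" by (rule smooth_on_cong[OF A, rotated]) (simp add: F_def)
    show "F x = 0" if "x \<notin> K" for x using K(3) that by (simp add: F_def)
  qed
  have pF: "partial_deriv b F x = partial_deriv b q x * (u x)\<^sup>2 + 2 * q x * u x * partial_deriv b u x"
    if x: "x \<in> A" for x
  proof -
    have "Ck_on (Suc 0) A q" using q unfolding smooth_on_def by blast
    then have dq: "q differentiable at x" using x by simp
    note du = test_function_differentiable[OF u, of x]
    have "partial_deriv b F x = partial_deriv b (\<lambda>x. q x * (u x * u x)) x"
      by (rule partial_deriv_cong[OF A x]) (simp add: F_def)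
    also have "\<dots> = q x * partial_deriv b (\<lambda>x. u x * u x) x + partial_deriv b q x * (u x * u x)"
      by (rule partial_deriv_mult[OF dq differentiable_mult[OF du du]])
    also have "partial_deriv b (\<lambda>x. u x * u x) x = u x * partial_deriv b u x + partial_deriv b u x * u x"
      by (rule partial_deriv_mult[OF du du])
    finally show ?thesis by (simp add: algebra_simps power2_eq_square)
  qed
  have le: "c x * (u x)\<^sup>2 \<le> (partial_deriv b u x)\<^sup>2 + partial_deriv b F x" for x
  proof (cases "x \<in> K")
    case True
    then have x: "x \<in> A" using K by auto
    have "c x * (u x)\<^sup>2 \<le> (partial_deriv b q x - (q x)\<^sup>2) * (u x)\<^sup>2"
      by (intro mult_right_mono c x) simp
    moreover have "0 \<le> (partial_deriv b u x + q x * u x)\<^sup>2" by simp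
    ultimately show ?thesis unfolding pF[OF x] by (simp add: power2_eq_square algebra_simps)
  next
    case False
    have "partial_deriv b F x = partial_deriv b (\<lambda>x. 0) x"
      by (rule partial_deriv_cong[of "- K"])
        (use K False in \<open>auto simp: compact_imp_closed F_def\<close>)
    then have "partial_deriv b F x = 0" using partial_deriv_eqI[OF has_derivative_const] by simp
    then show ?thesis using K False by simp
  qed
  have "(\<integral>x. c x * (u x)\<^sup>2 \<partial>lborel) \<le> (\<integral>x. (partial_deriv b u x)\<^sup>2 + partial_deriv b F x \<partial>lborel)"
    using test_function_partial_integrals[OF u b] test_function_partial_integrals[OF F b]
    by (intro integral_mono integrable_weighted_test[OF A c(1) u] le) auto
  also have "\<dots> = (\<integral>x. (partial_deriv b u x)\<^sup>2 \<partial>lborel)"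
    using test_function_partial_integrals[OF u b] test_function_partial_integrals[OF F b] by simp
  finally show ?thesis .
qed

lemma axis_real2_nth: "axis 1 1 $ (1::2) = (1::real)" "axis 2 1 $ (2::2) = (1::real)"
  by (simp_all add: axis_def)

definition angular_weight :: "real^2 \<Rightarrow> real" where "angular_weight w = 1 / (cos (w$2))\<^sup>2"

lemma continuous_on_angular_weight: "continuous_on strip angular_weight"
  unfolding angular_weight_def using cos_strip(1)
  by (auto intro!: continuous_intros simp: less_imp_neq[symmetric])

lemma Basis2 [simp]: "axis 1 1 \<in> (Basis :: (real^2) set)" "axis 2 1 \<in> (Basis :: (real^2) set)"
  by (simp_all add: Basis_real2)

text \<open>The choice \<open>h = cos (2 p)\<close>, positive on the strip, gives \<open>q = 2 tan (2 p)\<close> and the constant \<open>\<partial>q - q\<^sup>2 = 4\<close>,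
which is at least \<open>2 / (cos p)\<^sup>2\<close>.\<close>

lemma angular_poincare:
  assumes u: "u \<in> test_functions strip"
  shows "2 * (\<integral>w. angular_weight w * (u w)\<^sup>2 \<partial>lborel) \<le> (\<integral>w. (pd2 u w)\<^sup>2 \<partial>lborel)"
proof -
  define q :: "real^2 \<Rightarrow> real" where "q w = 2 * (sin (2 * w$2) * inverse (cos (2 * w$2)))" for w
  have c: "0 < cos (2 * w$2)" if "w \<in> strip" for w
    using that by (intro cos_gt_zero_pi) (auto simp: strip_def)
  have two: "smooth_on strip (\<lambda>w::real^2. 2 * w$2)"
    by (intro smooth_on_mult smooth_on_const smooth_on_nth open_strip)
  have sm: "smooth_on strip q" unfolding q_def
    by (intro smooth_on_mult[OF open_strip] smooth_on_const[OF open_strip]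
        smooth_on_compose_real[OF smooth_on_sin open_strip _ two]
        smooth_on_compose_real[OF smooth_on_inverse open_strip _
          smooth_on_compose_real[OF smooth_on_cos open_strip _ two]]) (use c in auto)
  have pq: "2 * angular_weight w \<le> pd2 q w - (q w)\<^sup>2" if w: "w \<in> strip" for w
  proof -
    have n: "cos (2 * w$2) \<noteq> 0" using c[OF w] by simp
    have sc: "4 * (y * (cos t * cos t)) + 4 * (y * (sin t * sin t)) = 4 * y" for y t :: real
      using sin_cos_squared_add[of t] by (simp add: power2_eq_square flip: distrib_left)
    have "(q has_derivative (\<lambda>h. 4 * (1 + (sin (2 * w$2) * inverse (cos (2 * w$2)))\<^sup>2) * h$2)) (at w)"
      unfolding q_def
      using n by (auto intro!: derivative_eq_intros bounded_linear_vec_nth[THEN bounded_linear_imp_has_derivative]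
          simp: fun_eq_iff field_simps power2_eq_square sc)
    from partial_deriv_eqI[OF this, of "axis 2 1"]
    have "pd2 q w = 4 * (1 + (sin (2 * w$2) * inverse (cos (2 * w$2)))\<^sup>2)"
      by (simp only: axis_real2_nth mult_1_right)
    then have "pd2 q w - (q w)\<^sup>2 = 4" by (simp add: q_def power_mult_distrib distrib_left)
    moreover have "2 * angular_weight w \<le> 4"
      using cos_strip[OF w] by (simp add: angular_weight_def field_simps)
    ultimately show ?thesis by simp
  qed
  have "(\<integral>w. (2 * angular_weight w) * (u w)\<^sup>2 \<partial>lborel) \<le> (\<integral>w. (pd2 u w)\<^sup>2 \<partial>lborel)"
    by (rule picone_inequality[OF open_strip _ u sm _ pq])
      (auto intro!: continuous_intros continuous_on_angular_weight)
  then show ?thesis by (simp add: mult.assoc)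
qed

definition radial_weight :: "real^2 \<Rightarrow> real" where "radial_weight w = 1 / (4 * (w$1)\<^sup>2)"

lemma continuous_on_radial_weight: "continuous_on strip radial_weight"
  unfolding radial_weight_def by (auto intro!: continuous_intros simp: strip_def)

text \<open>The one-dimensional Hardy inequality on a half-line, with \<open>h = sqrt (- s)\<close> and hence \<open>q = 1 / (2 (- s))\<close>.\<close>

lemma radial_hardy:
  assumes u: "u \<in> test_functions strip"
  shows "(\<integral>w. radial_weight w * (u w)\<^sup>2 \<partial>lborel) \<le> (\<integral>w. (pd1 u w)\<^sup>2 \<partial>lborel)"
proof (rule picone_inequality[OF open_strip _ u _ continuous_on_radial_weight])
  let ?q = "\<lambda>w::real^2. (1 / 2) * inverse (- w$1)"
  show "smooth_on strip ?q"
    by (intro smooth_on_mult[OF open_strip] smooth_on_const[OF open_strip]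
        smooth_on_compose_real[OF smooth_on_inverse open_strip _ smooth_on_uminus[OF open_strip smooth_on_nth[OF open_strip]]])
      (auto simp: strip_def)
  show "radial_weight w \<le> pd1 ?q w - (?q w)\<^sup>2" if w: "w \<in> strip" for w
  proof -
    have n: "w$1 \<noteq> 0" using w by (simp add: strip_def)
    have "(?q has_derivative (\<lambda>h. 1 / (2 * (w$1)\<^sup>2) * h$1)) (at w)"
      using n by (auto intro!: derivative_eq_intros bounded_linear_vec_nth[THEN bounded_linear_imp_has_derivative]
          simp: fun_eq_iff field_simps power2_eq_square)
    from partial_deriv_eqI[OF this, of "axis 1 1"] have p: "pd1 ?q w = 1 / (2 * (w$1)\<^sup>2)"
      by (simp only: axis_real2_nth mult_1_right)
    show ?thesis unfolding p radial_weight_def using n by (simp add: field_simps power2_eq_square)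
  qed
qed simp

text \<open>A dilation of the half-strip along its axis. It is not conformal: it changes the balance between the
two parts of the energy.\<close>

definition stretch :: "real \<Rightarrow> real^2 \<Rightarrow> real^2" where
  "stretch \<epsilon> w = vector [\<epsilon> * w$1, w$2]"

lemma stretch_nth [simp]: "stretch \<epsilon> w $ 1 = \<epsilon> * w$1" "stretch \<epsilon> w $ 2 = w$2"
  by (simp_all add: stretch_def)

lemma has_derivative_stretch: "(stretch \<epsilon> has_derivative stretch \<epsilon>) (at w)"
proof (rule bounded_linear_imp_has_derivative, rule linear_conv_bounded_linear[THEN iffD1])
  show "linear (stretch \<epsilon>)" by (rule linearI) (simp_all add: vec2_eq_iff algebra_simps)
qed

lemma stretch_test:
  assumes "0 < \<epsilon>" and u: "u \<in> test_functions strip"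
  shows "(\<lambda>w. u (stretch \<epsilon> w)) \<in> test_functions strip"
proof -
  have iff: "stretch \<epsilon> w \<in> strip \<longleftrightarrow> w \<in> strip" for w
    using assms(1) by (simp add: strip_def mult_less_0_iff)
  have "(\<lambda>w. if w \<in> strip then u (stretch \<epsilon> w) else 0) \<in> test_functions strip"
  proof (rule test_function_pullback[OF open_strip open_strip _ _ _ _ _ u, where R = "stretch (1 / \<epsilon>)"])
    show "stretch \<epsilon> ` strip \<subseteq> strip" using iff by blast
    show "stretch (1 / \<epsilon>) ` strip \<subseteq> strip"
      using assms(1) by (auto simp: strip_def divide_less_0_iff)
    show "stretch (1 / \<epsilon>) (stretch \<epsilon> w) = w" for w using assms(1) by (simp add: vec2_eq_iff)
    show "continuous_on strip (stretch (1 / \<epsilon>))"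
      by (intro continuous_at_imp_continuous_on ballI has_derivative_continuous[OF has_derivative_stretch])
    show "smooth_on strip (\<lambda>w. stretch \<epsilon> w \<bullet> c)" if "c \<in> Basis" for c
      using that by (auto simp: Basis_real2 inner_axis intro!: smooth_on_mult smooth_on_const smooth_on_nth open_strip)
  qed
  moreover have "(\<lambda>w. if w \<in> strip then u (stretch \<epsilon> w) else 0) = (\<lambda>w. u (stretch \<epsilon> w))"
    using iff test_function_zero[OF u] by (auto simp: fun_eq_iff)
  ultimately show ?thesis by simp
qed

lemma stretch_integral:
  fixes f :: "real^2 \<Rightarrow> real"
  assumes "0 < \<epsilon>" "integrable lborel f" "integrable lborel (\<lambda>w. f (stretch \<epsilon> w))"
  shows "integral\<^sup>L lborel f = \<epsilon> * (\<integral>w. f (stretch \<epsilon> w) \<partial>lborel)"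
proof -
  have inv: "stretch \<epsilon> (stretch (1 / \<epsilon>) w) = w" for w using assms(1) by (simp add: vec2_eq_iff)
  then have surj: "range (stretch \<epsilon>) = UNIV" by (metis surjI)
  have "(\<integral>w. \<epsilon> * f (stretch \<epsilon> w) \<partial>lborel) = integral\<^sup>L lborel f"
  proof (rule lborel_change_of_variables[OF open_UNIV _ has_derivative_stretch _ assms(2)])
    show "inj (stretch \<epsilon>)" using assms(1) by (auto simp: inj_def vec2_eq_iff)
    show "\<epsilon> * f (stretch \<epsilon> w) = \<bar>det (matrix (stretch \<epsilon>))\<bar> * f (stretch \<epsilon> w)" for w
      using assms(1) by (simp add: det_2 matrix_def axis_def)
  qed (use assms(3) surj in auto)
  then show ?thesis by simp
qed

lemma partial_derivs_stretch:
  assumes u: "u \<in> test_functions strip"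
  shows "pd1 (\<lambda>w. u (stretch \<epsilon> w)) w = \<epsilon> * pd1 u (stretch \<epsilon> w)"
    and "pd2 (\<lambda>w. u (stretch \<epsilon> w)) w = pd2 u (stretch \<epsilon> w)"
proof -
  have "((\<lambda>w. u (stretch \<epsilon> w)) has_derivative
      (\<lambda>h. stretch \<epsilon> h$1 * pd1 u (stretch \<epsilon> w) + stretch \<epsilon> h$2 * pd2 u (stretch \<epsilon> w))) (at w)"
    by (rule has_derivative_compose[OF has_derivative_stretch
        has_derivative_real2[OF test_function_differentiable[OF u]]])
  note p = partial_deriv_eqI[OF this]
  show "pd1 (\<lambda>w. u (stretch \<epsilon> w)) w = \<epsilon> * pd1 u (stretch \<epsilon> w)"
    and "pd2 (\<lambda>w. u (stretch \<epsilon> w)) w = pd2 u (stretch \<epsilon> w)"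
    unfolding p by (simp_all add: axis_def)
qed

text \<open>Testing the full inequality with \<open>u \<circ> stretch \<epsilon>\<close> and multiplying by \<open>\<epsilon>\<close> yields \<open>l * c \<le> \<epsilon>\<^sup>2 * a + b\<close>, where
\<open>a\<close> and \<open>b\<close> are the energies of \<open>u\<close> in the two directions and \<open>c\<close> is its weighted square norm. The
potential is invariant because it depends on the second coordinate only.\<close>

lemma angular_inequality_from_full:
  assumes u: "u \<in> test_functions strip"
    and full: "\<And>v. v \<in> test_functions strip \<Longrightarrow>
      l * (\<integral>w. angular_weight w * (v w)\<^sup>2 \<partial>lborel) \<le> (\<integral>w. (pd1 v w)\<^sup>2 \<partial>lborel) + (\<integral>w. (pd2 v w)\<^sup>2 \<partial>lborel)"
  shows "l * (\<integral>w. angular_weight w * (u w)\<^sup>2 \<partial>lborel) \<le> (\<integral>w. (pd2 u w)\<^sup>2 \<partial>lborel)"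
proof -
  define a where "a = (\<integral>w. (pd1 u w)\<^sup>2 \<partial>lborel)"
  define b where "b = (\<integral>w. (pd2 u w)\<^sup>2 \<partial>lborel)"
  define c where "c = (\<integral>w. angular_weight w * (u w)\<^sup>2 \<partial>lborel)"
  have key: "l * c \<le> \<epsilon>\<^sup>2 * a + b" if \<epsilon>: "0 < \<epsilon>" for \<epsilon>
  proof -
    let ?v = "\<lambda>w. u (stretch \<epsilon> w)"
    have v: "?v \<in> test_functions strip" by (rule stretch_test[OF \<epsilon> u])
    note iu = test_function_partial_integrals(1)[OF u Basis2(1)] test_function_partial_integrals(1)[OF u Basis2(2)]
    note iv = test_function_partial_integrals(1)[OF v Basis2(1)] test_function_partial_integrals(1)[OF v Basis2(2)]
    have ang: "angular_weight (stretch \<epsilon> w) = angular_weight w" for w by (simp add: angular_weight_def)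
    have i1: "integrable lborel (\<lambda>w. (pd1 u (stretch \<epsilon> w))\<^sup>2)"
      using iv(1) \<epsilon> unfolding partial_derivs_stretch[OF u] by (simp add: power_mult_distrib)
    have a: "a = \<epsilon> * (\<integral>w. (pd1 u (stretch \<epsilon> w))\<^sup>2 \<partial>lborel)"
      unfolding a_def by (rule stretch_integral[OF \<epsilon> iu(1) i1])
    have A: "\<epsilon>\<^sup>2 * a = \<epsilon> * (\<integral>w. (pd1 ?v w)\<^sup>2 \<partial>lborel)"
    proof -
      have "(\<integral>w. (pd1 ?v w)\<^sup>2 \<partial>lborel) = \<epsilon>\<^sup>2 * (\<integral>w. (pd1 u (stretch \<epsilon> w))\<^sup>2 \<partial>lborel)"
        unfolding partial_derivs_stretch[OF u] by (simp add: power_mult_distrib)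
      then show ?thesis using a by simp
    qed
    have B: "b = \<epsilon> * (\<integral>w. (pd2 ?v w)\<^sup>2 \<partial>lborel)"
      using stretch_integral[OF \<epsilon> iu(2)] iv(2) unfolding b_def partial_derivs_stretch[OF u] by simp
    have C: "c = \<epsilon> * (\<integral>w. angular_weight w * (?v w)\<^sup>2 \<partial>lborel)"
      using stretch_integral[OF \<epsilon> integrable_weighted_test[OF open_strip continuous_on_angular_weight u]]
        integrable_weighted_test[OF open_strip continuous_on_angular_weight v]
      unfolding c_def by (simp add: ang)
    have "l * c = \<epsilon> * (l * (\<integral>w. angular_weight w * (?v w)\<^sup>2 \<partial>lborel))" by (simp add: C)
    also have "\<dots> \<le> \<epsilon> * ((\<integral>w. (pd1 ?v w)\<^sup>2 \<partial>lborel) + (\<integral>w. (pd2 ?v w)\<^sup>2 \<partial>lborel))"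
      using full[OF v] \<epsilon> by (intro mult_left_mono) auto
    finally show ?thesis by (simp add: A B distrib_left)
  qed
  have "(\<lambda>n. (inverse (real (Suc n)))\<^sup>2 * a + b) \<longlonglongrightarrow> 0\<^sup>2 * a + b"
    by (intro tendsto_intros LIMSEQ_inverse_real_of_nat)
  then have "l * c \<le> 0\<^sup>2 * a + b"
    by (rule LIMSEQ_le_const) (auto intro!: key)
  then show ?thesis by (simp add: b_def c_def)
qed

section \<open>The Hardy constant\<close>

lemma integral_norm_grad:
  assumes "u \<in> test_functions strip"
  shows "(\<integral>w. (norm (grad u w))\<^sup>2 \<partial>lborel) = (\<integral>w. (pd1 u w)\<^sup>2 \<partial>lborel) + (\<integral>w. (pd2 u w)\<^sup>2 \<partial>lborel)"
  unfolding norm_grad_sq_real2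
  using test_function_partial_integrals(1)[OF assms Basis2(1)] test_function_partial_integrals(1)[OF assms Basis2(2)]
  by simp

text \<open>This moves an inequality for test functions on the strip to all of \<open>W12_0 Omega\<close>.\<close>

lemma W12_0_strip_inequality:
  assumes Q: "continuous_on strip Q" "\<And>w. w \<in> strip \<Longrightarrow> 0 \<le> Q w"
    and test: "\<And>v. v \<in> test_functions strip \<Longrightarrow>
      (\<integral>w. Q w * (v w)\<^sup>2 \<partial>lborel) \<le> (\<integral>w. (pd1 v w)\<^sup>2 \<partial>lborel) + (\<integral>w. (pd2 v w)\<^sup>2 \<partial>lborel)"
    and ug: "(u, g) \<in> W12_0 Omega"
  shows "(\<integral>\<^sup>+x. ennreal (weight_on_Omega Q x * (u x)\<^sup>2) \<partial>lebesgue_on Omega) \<le> L2_sq Omega g"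
proof (rule W12_0_weighted_inequality[OF open_Omega weight_on_Omega_borel[OF Q(1)] _ _ ug])
  show "0 \<le> weight_on_Omega Q x" for x
    using Q(2)[OF phi_Omega] jac_pos[of "phi x"] by (auto simp: weight_on_Omega_def intro!: divide_nonneg_pos)
  show "(\<integral>\<^sup>+x. ennreal (weight_on_Omega Q x * (\<phi> x)\<^sup>2) \<partial>lebesgue_on Omega) \<le> L2_sq Omega (grad \<phi>)"
    if "\<phi> \<in> test_functions Omega" for \<phi>
  proof -
    have "(\<integral>\<^sup>+x. ennreal (weight_on_Omega Q x * (\<phi> x)\<^sup>2) \<partial>lebesgue_on Omega)
        = ennreal (\<integral>w. Q w * (to_strip \<phi> w)\<^sup>2 \<partial>lborel)"
      by (rule weighted_transfer[OF that Q])
    also have "\<dots> \<le> L2_sq Omega (grad \<phi>)"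
      unfolding energy_transfer[OF that] integral_norm_grad[OF to_strip_test[OF that]]
      by (rule ennreal_leI, rule test[OF to_strip_test[OF that]])
    finally show ?thesis .
  qed
qed

definition hardy_denominator :: "(real^2 \<Rightarrow> real) \<Rightarrow> ennreal" where
  "hardy_denominator u = (\<integral>\<^sup>+x. ennreal (weight_on_Omega angular_weight x * (u x)\<^sup>2) \<partial>lebesgue_on Omega)"

lemma hardy_quotient_Omega: "hardy_quotient Omega u g = L2_sq Omega g / hardy_denominator u"
proof -
  have eq: "\<bar>u x\<bar>\<^sup>2 / ((norm x)\<^sup>2 * (ln (outer_radius Omega / norm x))\<^sup>2)
      = weight_on_Omega angular_weight x * (u x)\<^sup>2" if "x \<in> Omega" for x
    using hardy_weight_psi[OF phi_Omega[OF that]] that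
    by (simp add: psi_phi_Omega hardy_weight_def weight_on_Omega_def angular_weight_def)
  have "(\<integral>\<^sup>+x. ennreal (\<bar>u x\<bar>\<^sup>2 / ((norm x)\<^sup>2 * (ln (outer_radius Omega / norm x))\<^sup>2)) \<partial>lebesgue_on Omega)
      = hardy_denominator u"
    unfolding hardy_denominator_def
    by (rule nn_integral_cong) (use eq in \<open>simp add: space_restrict_space\<close>)
  then show ?thesis by (simp add: hardy_quotient_def L2_sq_def)
qed

lemma angular_weight_pos: "w \<in> strip \<Longrightarrow> 0 < angular_weight w"
  using cos_strip(1)[of w] by (simp add: angular_weight_def)

lemma AE_zero_if_weighted_integral_zero:
  assumes u: "u \<in> borel_measurable (lebesgue_on Omega)"
    and Q: "continuous_on strip Q" "\<And>w. w \<in> strip \<Longrightarrow> 0 < Q w"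
    and z: "(\<integral>\<^sup>+x. ennreal (weight_on_Omega Q x * (u x)\<^sup>2) \<partial>lebesgue_on Omega) = 0"
  shows "AE x in lebesgue_on Omega. u x = 0"
proof -
  have [measurable]: "weight_on_Omega Q \<in> borel_measurable (lebesgue_on Omega)"
    using weight_on_Omega_borel[OF Q(1)] by (simp add: measurable_completion measurable_restrict_space1)
  have "AE x in lebesgue_on Omega. ennreal (weight_on_Omega Q x * (u x)\<^sup>2) = 0"
    using z u by (subst (asm) nn_integral_0_iff_AE) auto
  moreover have "AE x in lebesgue_on Omega. x \<in> Omega" by (rule AE_I2) (simp add: space_restrict_space)
  ultimately show ?thesis
  proof eventually_elim
    case (elim x)
    have "0 < weight_on_Omega Q x"
      using elim(2) Q(2)[OF phi_Omega] jac_pos by (simp add: weight_on_Omega_def)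
    then show ?case using elim(1) by (simp add: ennreal_eq_0_iff mult_le_0_iff)
  qed
qed

text \<open>What makes the quotient a positive real number: the denominator is positive because the weight is,
and finite because \<open>angular_poincare\<close> bounds it by the energy.\<close>

lemma W12_0_nonzero_denominator:
  assumes "(u, g) \<in> W12_0_nonzero Omega"
  shows "hardy_denominator u \<noteq> 0" "2 * hardy_denominator u \<le> L2_sq Omega g" "L2_sq Omega g < \<infinity>"
proof -
  have ug: "(u, g) \<in> W12_0 Omega" and nz: "\<not> (AE x in lebesgue_on Omega. u x = 0)"
    and u: "u \<in> borel_measurable (lebesgue_on Omega)" and g: "L2_sq Omega g < \<infinity>"
    using assms by (auto simp: W12_0_nonzero_def W12_0_def W12_def L2_def)
  show "L2_sq Omega g < \<infinity>" by (rule g)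
  show "hardy_denominator u \<noteq> 0"
    using AE_zero_if_weighted_integral_zero[OF u continuous_on_angular_weight angular_weight_pos] nz
    by (auto simp: hardy_denominator_def)
  have [measurable]: "weight_on_Omega angular_weight \<in> borel_measurable (lebesgue_on Omega)"
    using weight_on_Omega_borel[OF continuous_on_angular_weight]
    by (simp add: measurable_completion measurable_restrict_space1)
  note [measurable] = u
  have "2 * hardy_denominator u
      = (\<integral>\<^sup>+x. ennreal (weight_on_Omega (\<lambda>w. 2 * angular_weight w) x * (u x)\<^sup>2) \<partial>lebesgue_on Omega)"
    unfolding hardy_denominator_def
  proof (subst nn_integral_cmult[symmetric])
    show "(\<integral>\<^sup>+x. 2 * ennreal (weight_on_Omega angular_weight x * (u x)\<^sup>2) \<partial>lebesgue_on Omega)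
      = (\<integral>\<^sup>+x. ennreal (weight_on_Omega (\<lambda>w. 2 * angular_weight w) x * (u x)\<^sup>2) \<partial>lebesgue_on Omega)"
    proof (rule nn_integral_cong)
      fix x
      have eq: "weight_on_Omega (\<lambda>w. 2 * angular_weight w) x * (u x)\<^sup>2
          = 2 * (weight_on_Omega angular_weight x * (u x)\<^sup>2)" by (simp add: weight_on_Omega_def)
      show "2 * ennreal (weight_on_Omega angular_weight x * (u x)\<^sup>2)
          = ennreal (weight_on_Omega (\<lambda>w. 2 * angular_weight w) x * (u x)\<^sup>2)"
        unfolding eq by (simp add: ennreal_mult')
    qed
  qed measurable
  also have "\<dots> \<le> L2_sq Omega g"
  proof (rule W12_0_strip_inequality[OF _ _ _ ug])
    show "continuous_on strip (\<lambda>w. 2 * angular_weight w)"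
      by (intro continuous_intros continuous_on_angular_weight)
    show "0 \<le> 2 * angular_weight w" if "w \<in> strip" for w using angular_weight_pos[OF that] by simp
    show "(\<integral>w. 2 * angular_weight w * (v w)\<^sup>2 \<partial>lborel)
        \<le> (\<integral>w. (pd1 v w)\<^sup>2 \<partial>lborel) + (\<integral>w. (pd2 v w)\<^sup>2 \<partial>lborel)"
      if v: "v \<in> test_functions strip" for v
    proof -
      have "2 * (\<integral>w. angular_weight w * (v w)\<^sup>2 \<partial>lborel)
          \<le> (\<integral>w. (pd1 v w)\<^sup>2 \<partial>lborel) + (\<integral>w. (pd2 v w)\<^sup>2 \<partial>lborel)"
        by (rule add_increasing[OF _ angular_poincare[OF v]]) simp
      then show ?thesis by (simp add: mult.assoc)
    qed
  qed
  finally show "2 * hardy_denominator u \<le> L2_sq Omega g" .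
qed

lemma W12_0_nonzero_quotient:
  assumes "(u, g) \<in> W12_0_nonzero Omega"
  obtains N D where "L2_sq Omega g = ennreal N" "hardy_denominator u = ennreal D"
    "0 < D" "2 * D \<le> N" "hardy_quotient Omega u g = ennreal (N / D)"
proof -
  note d = W12_0_nonzero_denominator[OF assms]
  obtain N where N: "L2_sq Omega g = ennreal N" "0 \<le> N" using d(3) by (cases "L2_sq Omega g") auto
  have "hardy_denominator u \<noteq> \<infinity>"
  proof
    assume "hardy_denominator u = \<infinity>"
    then show False using d(2,3) by (simp add: ennreal_mult_top top_unique)
  qed
  then obtain D where D: "hardy_denominator u = ennreal D" "0 \<le> D"
    by (cases "hardy_denominator u") auto
  with d(1) have D0: "0 < D" by (simp add: less_le)
  have "ennreal (2 * D) \<le> ennreal N" using d(2) D N by (simp add: ennreal_mult)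
  then have "2 * D \<le> N" using N by (simp add: ennreal_le_iff)
  moreover have "hardy_quotient Omega u g = ennreal (N / D)"
    unfolding hardy_quotient_Omega N(1) D(1) using N D0 by (simp add: divide_ennreal)
  ultimately show ?thesis using that N(1) D(1) D0 by blast
qed

lemma C2_Omega_ge: "2 \<le> C2 Omega"
  unfolding C2_def
proof (rule INF_greatest, clarify)
  fix u :: "real^2 \<Rightarrow> real" and g assume "(u, g) \<in> W12_0_nonzero Omega"
  then obtain N D where "0 < D" "2 * D \<le> N" and q: "hardy_quotient Omega u g = ennreal (N / D)"
    by (rule W12_0_nonzero_quotient)
  then have "2 \<le> N / D" by (simp add: field_simps)
  then have "ennreal 2 \<le> ennreal (N / D)" by (rule ennreal_leI)
  then show "2 \<le> hardy_quotient Omega u g" unfolding q by simp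
qed

text \<open>The definition of the infimum, tested with the function on \<open>Omega\<close> that corresponds to \<open>v\<close>.\<close>

lemma C2_strip_inequality:
  assumes C: "C2 Omega = ennreal l" "0 \<le> l" and v: "v \<in> test_functions strip"
  shows "l * (\<integral>w. angular_weight w * (v w)\<^sup>2 \<partial>lborel)
    \<le> (\<integral>w. (pd1 v w)\<^sup>2 \<partial>lborel) + (\<integral>w. (pd2 v w)\<^sup>2 \<partial>lborel)"
proof -
  let ?u = "from_strip v"
  define d where "d = (\<integral>w. angular_weight w * (v w)\<^sup>2 \<partial>lborel)"
  define n where "n = (\<integral>w. (pd1 v w)\<^sup>2 \<partial>lborel) + (\<integral>w. (pd2 v w)\<^sup>2 \<partial>lborel)"
  have u: "?u \<in> test_functions Omega" by (rule from_strip_test[OF v])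
  have D: "hardy_denominator ?u = ennreal d"
    unfolding hardy_denominator_def d_def
    using weighted_transfer[OF u continuous_on_angular_weight less_imp_le[OF angular_weight_pos]]
    by (simp add: to_from_strip[OF v])
  have N: "L2_sq Omega (grad ?u) = ennreal n"
    unfolding energy_transfer[OF u] to_from_strip[OF v] integral_norm_grad[OF v] n_def ..
  have n0: "0 \<le> n" unfolding n_def by (intro add_nonneg_nonneg integral_nonneg_AE) auto
  have "l * d \<le> n"
  proof (cases "d \<le> 0")
    case True
    then show ?thesis using C(2) n0 by (meson mult_nonneg_nonpos order_trans)
  next
    case False
    have "\<not> (AE x in lebesgue_on Omega. ?u x = 0)"
    proof
      assume "AE x in lebesgue_on Omega. ?u x = 0"
      then have "hardy_denominator ?u = (\<integral>\<^sup>+x. 0 \<partial>lebesgue_on Omega)"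
        unfolding hardy_denominator_def by (intro nn_integral_cong_AE) auto
      then show False using D False by (simp add: ennreal_eq_0_iff)
    qed
    then have "(?u, grad ?u) \<in> W12_0_nonzero Omega"
      using test_function_in_W12_0[OF open_Omega u] by (simp add: W12_0_nonzero_def)
    then have "C2 Omega \<le> hardy_quotient Omega ?u (grad ?u)"
      unfolding C2_def by (rule INF_lower2) simp
    then have "ennreal l \<le> ennreal (n / d)"
      using False n0 by (simp add: hardy_quotient_Omega C N D divide_ennreal)
    then show ?thesis using False n0 by (simp add: ennreal_le_iff field_simps)
  qed
  then show ?thesis by (simp add: d_def n_def)
qed

text \<open>For a minimiser \<open>(u, g)\<close> the energy equals \<open>l\<close> times the denominator. The sharpened inequality, whose
potential is \<open>l / (cos p)\<^sup>2 + 1 / (4 s\<^sup>2)\<close>, then leaves nothing for the second term, and its weight is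
positive on all of \<open>Omega\<close>.\<close>

lemma not_C2_attained_Omega: "\<not> C2_attained Omega"
proof
  assume "C2_attained Omega"
  then obtain u g where ug: "(u, g) \<in> W12_0_nonzero Omega" and eq: "hardy_quotient Omega u g = C2 Omega"
    by (auto simp: C2_attained_def)
  have ug0: "(u, g) \<in> W12_0 Omega" and nz: "\<not> (AE x in lebesgue_on Omega. u x = 0)"
    and u[measurable]: "u \<in> borel_measurable (lebesgue_on Omega)"
    using ug by (auto simp: W12_0_nonzero_def W12_0_def W12_def L2_def)
  obtain N D where N: "L2_sq Omega g = ennreal N" and D: "hardy_denominator u = ennreal D" "0 < D"
    and ND: "2 * D \<le> N" and q: "hardy_quotient Omega u g = ennreal (N / D)"
    using ug by (rule W12_0_nonzero_quotient)
  define l where "l = N / D"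
  have l: "0 \<le> l" "N = l * D" using ND D by (simp_all add: l_def)
  have C: "C2 Omega = ennreal l" using eq q by (simp add: l_def)
  define Q where "Q w = l * angular_weight w + radial_weight w" for w
  have rpos: "0 < radial_weight w" if "w \<in> strip" for w
    using that by (simp add: radial_weight_def strip_def)
  have "(\<integral>\<^sup>+x. ennreal (weight_on_Omega Q x * (u x)\<^sup>2) \<partial>lebesgue_on Omega) \<le> L2_sq Omega g"
  proof (rule W12_0_strip_inequality[OF _ _ _ ug0])
    show "continuous_on strip Q" unfolding Q_def
      by (intro continuous_intros continuous_on_angular_weight continuous_on_radial_weight)
    show "0 \<le> Q w" if "w \<in> strip" for w
      using angular_weight_pos[OF that] rpos[OF that] l by (simp add: Q_def)
    fix v assume v: "v \<in> test_functions strip"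
    have "(\<integral>w. Q w * (v w)\<^sup>2 \<partial>lborel)
        = l * (\<integral>w. angular_weight w * (v w)\<^sup>2 \<partial>lborel) + (\<integral>w. radial_weight w * (v w)\<^sup>2 \<partial>lborel)"
      unfolding Q_def using integrable_weighted_test[OF open_strip continuous_on_angular_weight v]
        integrable_weighted_test[OF open_strip continuous_on_radial_weight v]
      by (simp add: distrib_right mult.assoc)
    also have "\<dots> \<le> (\<integral>w. (pd2 v w)\<^sup>2 \<partial>lborel) + (\<integral>w. (pd1 v w)\<^sup>2 \<partial>lborel)"
      by (intro add_mono radial_hardy v angular_inequality_from_full C2_strip_inequality[OF C l(1)])
    finally show "(\<integral>w. Q w * (v w)\<^sup>2 \<partial>lborel)
        \<le> (\<integral>w. (pd1 v w)\<^sup>2 \<partial>lborel) + (\<integral>w. (pd2 v w)\<^sup>2 \<partial>lborel)" by simp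
  qed
  moreover have "(\<integral>\<^sup>+x. ennreal (weight_on_Omega Q x * (u x)\<^sup>2) \<partial>lebesgue_on Omega)
      = ennreal l * hardy_denominator u
        + (\<integral>\<^sup>+x. ennreal (weight_on_Omega radial_weight x * (u x)\<^sup>2) \<partial>lebesgue_on Omega)"
  proof -
    have [measurable]: "weight_on_Omega angular_weight \<in> borel_measurable (lebesgue_on Omega)"
        "weight_on_Omega radial_weight \<in> borel_measurable (lebesgue_on Omega)"
      using weight_on_Omega_borel[OF continuous_on_angular_weight] weight_on_Omega_borel[OF continuous_on_radial_weight]
      by (simp_all add: measurable_completion measurable_restrict_space1)
    have pt: "ennreal (weight_on_Omega Q x * (u x)\<^sup>2)
        = ennreal l * ennreal (weight_on_Omega angular_weight x * (u x)\<^sup>2)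
          + ennreal (weight_on_Omega radial_weight x * (u x)\<^sup>2)" for x
    proof -
      have nn: "0 \<le> weight_on_Omega angular_weight x" "0 \<le> weight_on_Omega radial_weight x"
        using angular_weight_pos[OF phi_Omega, of x] rpos[OF phi_Omega, of x] jac_pos[of "phi x"]
        by (auto simp: weight_on_Omega_def less_imp_le)
      have "weight_on_Omega Q x = l * weight_on_Omega angular_weight x + weight_on_Omega radial_weight x"
        by (simp add: weight_on_Omega_def Q_def add_divide_distrib)
      then show ?thesis using nn l(1)
        by (simp add: distrib_right mult.assoc ennreal_mult[symmetric] ennreal_plus[symmetric] del: ennreal_plus)
    qed
    show ?thesis unfolding pt hardy_denominator_def
      by (subst nn_integral_add) (auto simp: nn_integral_cmult)
  qed
  moreover have "ennreal l * hardy_denominator u = L2_sq Omega g"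
    using l D by (simp add: N D(1) ennreal_mult)
  ultimately have "ennreal N + (\<integral>\<^sup>+x. ennreal (weight_on_Omega radial_weight x * (u x)\<^sup>2) \<partial>lebesgue_on Omega) \<le> ennreal N + 0"
    by (simp add: N)
  then have "(\<integral>\<^sup>+x. ennreal (weight_on_Omega radial_weight x * (u x)\<^sup>2) \<partial>lebesgue_on Omega) \<le> 0"
    by (subst (asm) ennreal_add_left_cancel_le) auto
  then have "AE x in lebesgue_on Omega. u x = 0"
    by (intro AE_zero_if_weighted_integral_zero[OF u continuous_on_radial_weight rpos]) auto
  with nz show False ..
qed

theorem theorem6:
  shows "\<exists>\<Omega> :: (real^2) set. domain_set \<Omega> \<and> \<Omega> \<subseteq> ball 0 1 \<and> (SUP x\<in>\<Omega>. norm x) = 1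
           \<and> C2 \<Omega> > 1 / 4 \<and> \<not> C2_attained \<Omega>"
proof (intro exI conjI)
  have "(1::ennreal) / 4 < 2"
  proof -
    have "(1::ennreal) / 4 = ennreal (1 / 4)" by (simp add: divide_ennreal[symmetric])
    also have "\<dots> < ennreal 2" by (rule ennreal_lessI) auto
    finally show ?thesis by simp
  qed
  then show "C2 Omega > 1 / 4" using C2_Omega_ge by (rule order_less_le_trans)
qed (rule domain_set_Omega Omega_subset_ball SUP_norm_Omega not_C2_attained_Omega)+

end
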